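(* Let $(\mathcal F,\int)$ be an ordinary shifted Rota-Baxter algebra over an ordered field $K$. Then $(\mathcal P_2\mathcal F,I^x,I^\xi)$ is a duplex Rota-Baxter algebra (i.e. both $(\mathcal P_2\mathcal F,I^x)$ and $(\mathcal P_2\mathcal F,I^\xi)$ are Rota-Baxter algebras over $K$) that extends $(\mathcal F_2,\int^x,\int^\xi)$.
   Context: All algebras are commutative and unital. **Heaviside operator.** $H\colon K\to K$ is $H(a)=0$ for $a\le 0$ and $H(a)=1$ for $a>0$; $\bar H(a)=1-H(a)$; $a\sqcup b=\max(a,b)$. **Rota-Baxter algebras.** A Rota-Baxter algebra $(\mathcal F,\int)$ over $K$ is a $K$-algebra with a $K$-linear map $\int$ satisfying $(\int f)(\int g)=\int(f\int g)+\int(g\int f)$. It is ordinary if $\int$ is injective and $\mathcal F=\operatorname{Im}(\int)\oplus K$; the projector $\mathsf e$ onto $K$ along $\operatorname{Im}(\int)$ is then a $K$-algebra homomorphism. It is shifted if there is a group homomorphism $S\colon(K,+)\to\operatorname{Aut}_K(\mathcal F)$, $c\mapsto S_c$, with $S_c\int-\int S_c=\mathsf e_c\int$ for all $c$, where $\mathsf e_c:=\mathsf e\circ S_c$. Set $\int_c:=(1-\mathsf e_c)\int$ and $\int_c^d:=\mathsf e_d\int_c\in\mathcal F^*$. **Bivariate functions.** $\mathcal F_2:=\mathcal F\otimes_K\mathcal F$, with $f(x):=f\otimes1$, $f(\xi):=1\otimes f$, $\int^x(f_1\otimes f_2)=(\int f_1)\otimes f_2$, $\int^\xi(f_1\otimes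 f_2)=f_1\otimes\int f_2$. **Bivariate piecewise extension.** $\mathcal P_{x\xi}\mathcal F$ is the free $\mathcal F_2$-module with basis $1,\ H_a(x),\ H_a(\xi),\ H_a(x)H_b(\xi)$ $(a,b\in K)$, an $\mathcal F_2$-algebra via $H_a(x)H_b(x)=H_{a\sqcup b}(x)$ and $H_a(\xi)H_b(\xi)=H_{a\sqcup b}(\xi)$; put $\bar H_a(x)=1-H_a(x)$, $\bar H_a(\xi)=1-H_a(\xi)$. Next, $\mathcal P_2\mathcal F$ is the $\mathcal P_{x\xi}\mathcal F$-algebra generated by one element $\hat H$ (written $H(x-\xi)$) subject to $$\hat H^2=\hat H,\qquad H_a(x)\hat H=H_a(\xi)\hat H+H_a(x)\bar H_a(\xi)\quad(a\in K).$$ It is a free $\mathcal F_2$-module on the basis $1,\ H_a(x),\ H_a(\xi),\ H_a(x)H_b(\xi)$ $(a,b\in K)$ of $\mathcal P_{x\xi}\mathcal F$ together with $\{\hat H,H_a(\xi)\hat H\mid a\in K\}$, or alternatively together with $\{\hat H,H_a(x)\hat H\mid a\in K\}$. **Operators.** $I^x\colon\mathcal P_2\mathcal F\to\mathcal P_2\mathcal F$ is the $K$-linear map that commutes with multiplication by all $g(\xi)$ $(g\in\mathcal F)$ and all $H_a(\xi)$ and satisfies, for $f\in\mathcal F$, $a\in K$ and $F:=\int f$, $$I^xf(x)=F(x),\quad I^x\big(f(x)H_a(x)\big)=\Big(\int_af\Big)(x)\,H_a(x)+\bar H(a)\int_0^af,$$ $$I^x\big(f(x)\hat H\big)=\big(F(x)-F(\xi)\big)\hat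 H+F(\xi)\,\bar H_0(\xi).$$ Likewise $I^\xi$ is the $K$-linear map that commutes with multiplication by all $f(x)$ and all $H_a(x)$ and satisfies, for $g\in\mathcal F$ and $G:=\int g$, $$I^\xi g(\xi)=G(\xi),\quad I^\xi\big(g(\xi)H_a(\xi)\big)=\Big(\int_ag\Big)(\xi)\,H_a(\xi)+\bar H(a)\int_0^ag,$$ $$I^\xi\big(g(\xi)\hat H\big)=\big(G(\xi)-G(x)\big)\hat H+G(x)\,H_0(x).$$ *)

theory Defs
  imports
    "HOL-Library.Poly_Mapping"
    "HOL-Library.Product_Plus"
    "HOL-Computational_Algebra.Polynomial"
begin

section \<open>Algebras and Rota-Baxter algebras over a field\<close>

text \<open>
  A commutative unital algebra over \<open>'k\<close> is a commutative ring type together with its scalar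
  multiplication. The field \<open>'k\<close> sits inside the algebra as the set of all \<open>s c 1\<close>.
\<close>

definition k_algebra :: "('k::field \<Rightarrow> 'a::comm_ring_1 \<Rightarrow> 'a) \<Rightarrow> bool" where
  "k_algebra s \<longleftrightarrow> vector_space s \<and> (\<forall>c x y. s c (x * y) = s c x * y)"

definition k_algebra_hom ::
  "('k::field \<Rightarrow> 'a::comm_ring_1 \<Rightarrow> 'a) \<Rightarrow> ('k \<Rightarrow> 'b::comm_ring_1 \<Rightarrow> 'b) \<Rightarrow> ('a \<Rightarrow> 'b) \<Rightarrow> bool"
  where
  "k_algebra_hom s t h \<longleftrightarrow>
     Vector_Spaces.linear s t h \<and> h 1 = 1 \<and> (\<forall>x y. h (x * y) = h x * h y)"

definition rota_baxter_algebra ::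
  "('k::field \<Rightarrow> 'a::comm_ring_1 \<Rightarrow> 'a) \<Rightarrow> ('a \<Rightarrow> 'a) \<Rightarrow> bool" where
  "rota_baxter_algebra s I \<longleftrightarrow>
     k_algebra s \<and> Vector_Spaces.linear s s I \<and>
     (\<forall>f g. I f * I g = I (f * I g) + I (g * I f))"

definition ordinary_rota_baxter ::
  "('k::field \<Rightarrow> 'a::comm_ring_1 \<Rightarrow> 'a) \<Rightarrow> ('a \<Rightarrow> 'a) \<Rightarrow> bool" where
  "ordinary_rota_baxter s I \<longleftrightarrow>
     rota_baxter_algebra s I \<and> inj I \<and>
     (\<forall>f. \<exists>g c. f = I g + s c 1) \<and> range I \<inter> range (\<lambda>c. s c 1) = {0}"

text \<open>The projector onto \<open>'k\<close> along the image of \<open>I\<close>, with values in \<open>'k\<close> itself.\<close>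

definition eval_proj ::
  "('k::field \<Rightarrow> 'a::comm_ring_1 \<Rightarrow> 'a) \<Rightarrow> ('a \<Rightarrow> 'a) \<Rightarrow> 'a \<Rightarrow> 'k" where
  "eval_proj s I f = (THE c. \<exists>g. f = I g + s c 1)"

definition eval_at ::
  "('k::field \<Rightarrow> 'a::comm_ring_1 \<Rightarrow> 'a) \<Rightarrow> ('a \<Rightarrow> 'a) \<Rightarrow> ('k \<Rightarrow> 'a \<Rightarrow> 'a) \<Rightarrow> 'k \<Rightarrow> 'a \<Rightarrow> 'k" where
  "eval_at s I S c f = eval_proj s I (S c f)"

definition shifted_rota_baxter ::
  "('k::field \<Rightarrow> 'a::comm_ring_1 \<Rightarrow> 'a) \<Rightarrow> ('a \<Rightarrow> 'a) \<Rightarrow> ('k \<Rightarrow> 'a \<Rightarrow> 'a) \<Rightarrow> bool" where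
  "shifted_rota_baxter s I S \<longleftrightarrow>
     (\<forall>c. k_algebra_hom s s (S c) \<and> bij (S c)) \<and>
     (\<forall>c d. S (c + d) = S c \<circ> S d) \<and>
     (\<forall>c f. S c (I f) - I (S c f) = s (eval_at s I S c (I f)) 1)"

definition int_from ::
  "('k::field \<Rightarrow> 'a::comm_ring_1 \<Rightarrow> 'a) \<Rightarrow> ('a \<Rightarrow> 'a) \<Rightarrow> ('k \<Rightarrow> 'a \<Rightarrow> 'a) \<Rightarrow> 'k \<Rightarrow> 'a \<Rightarrow> 'a" where
  "int_from s I S c f = I f - s (eval_at s I S c (I f)) 1"

definition int_from_to ::
  "('k::field \<Rightarrow> 'a::comm_ring_1 \<Rightarrow> 'a) \<Rightarrow> ('a \<Rightarrow> 'a) \<Rightarrow> ('k \<Rightarrow> 'a \<Rightarrow> 'a) \<Rightarrow> 'k \<Rightarrow> 'k \<Rightarrow> 'a \<Rightarrow> 'k"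
  where
  "int_from_to s I S c d f = eval_at s I S d (int_from s I S c f)"

definition heaviside :: "'k::linordered_field \<Rightarrow> 'k" where
  "heaviside a = (if a \<le> 0 then 0 else 1)"

definition heaviside_bar :: "'k::linordered_field \<Rightarrow> 'k" where
  "heaviside_bar a = 1 - heaviside a"

section \<open>The tensor square of an algebra\<close>

text \<open>
  The tensor square depends on the scalar multiplication, which is a term, so it cannot be a type
  constructor applied to the type of the algebra. Instead, \<open>tensor_square s s2 tens\<close> says that
  \<open>'t\<close>, with scalar multiplication \<open>s2\<close> and pure tensors \<open>tens f g\<close>, is a copy of
  the usual construction: the canonical map from the free module on all pairs \<open>(f, g)\<close> is onto,
  its kernel is spanned by the bilinearity relations, and multiplication is componentwise.
\<close>

definition free_scale :: "'k::field \<Rightarrow> ('x \<Rightarrow>\<^sub>0 'k) \<Rightarrow> ('x \<Rightarrow>\<^sub>0 'k)" where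
  "free_scale c p = Poly_Mapping.map ((*) c) p"

definition tensor_relations ::
  "('k::field \<Rightarrow> 'a::comm_ring_1 \<Rightarrow> 'a) \<Rightarrow> ('a \<times> 'a \<Rightarrow>\<^sub>0 'k) set" where
  "tensor_relations s =
     {Poly_Mapping.single (f + f', g) 1 - Poly_Mapping.single (f, g) 1
        - Poly_Mapping.single (f', g) 1 | f f' g. True} \<union>
     {Poly_Mapping.single (f, g + g') 1 - Poly_Mapping.single (f, g) 1
        - Poly_Mapping.single (f, g') 1 | f g g'. True} \<union>
     {Poly_Mapping.single (s c f, g) 1 - Poly_Mapping.single (f, g) c | c f g. True} \<union>
     {Poly_Mapping.single (f, s c g) 1 - Poly_Mapping.single (f, g) c | c f g. True}"

definition tensor_eval ::
  "('k::field \<Rightarrow> 't::comm_ring_1 \<Rightarrow> 't) \<Rightarrow> ('a \<Rightarrow> 'a \<Rightarrow> 't) \<Rightarrow> ('a \<times> 'a \<Rightarrow>\<^sub>0 'k) \<Rightarrow> 't" where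
  "tensor_eval s2 tens p =
     (\<Sum>x\<in>Poly_Mapping.keys p. s2 (Poly_Mapping.lookup p x) (tens (fst x) (snd x)))"

definition tensor_square ::
  "('k::field \<Rightarrow> 'a::comm_ring_1 \<Rightarrow> 'a) \<Rightarrow> ('k \<Rightarrow> 't::comm_ring_1 \<Rightarrow> 't)
     \<Rightarrow> ('a \<Rightarrow> 'a \<Rightarrow> 't) \<Rightarrow> bool" where
  "tensor_square s s2 tens \<longleftrightarrow>
     k_algebra s2 \<and>
     surj (tensor_eval s2 tens) \<and>
     {p. tensor_eval s2 tens p = 0} = module.span free_scale (tensor_relations s) \<and>
     tens 1 1 = 1 \<and>
     (\<forall>f g f' g'. tens f g * tens f' g' = tens (f * f') (g * g'))"

definition int2_x ::
  "('a \<Rightarrow> 'a) \<Rightarrow> ('k::field \<Rightarrow> 't::comm_ring_1 \<Rightarrow> 't) \<Rightarrow> ('a \<Rightarrow> 'a \<Rightarrow> 't) \<Rightarrow> 't \<Rightarrow> 't" where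
  "int2_x I s2 tens =
     (THE J. Vector_Spaces.linear s2 s2 J \<and> (\<forall>f g. J (tens f g) = tens (I f) g))"

definition int2_xi ::
  "('a \<Rightarrow> 'a) \<Rightarrow> ('k::field \<Rightarrow> 't::comm_ring_1 \<Rightarrow> 't) \<Rightarrow> ('a \<Rightarrow> 'a \<Rightarrow> 't) \<Rightarrow> 't \<Rightarrow> 't" where
  "int2_xi I s2 tens =
     (THE J. Vector_Spaces.linear s2 s2 J \<and> (\<forall>f g. J (tens f g) = tens f (I g)))"

section \<open>Bivariate piecewise extensions\<close>

text \<open>
  The index \<open>NoStep\<close> stands for the basis element \<open>1\<close>, and \<open>Step a\<close> for the Heaviside
  function at \<open>a\<close>. Addition of indices is multiplication of the corresponding basis elements.
\<close>

datatype 'k step = NoStep | Step 'k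

instantiation step :: (linorder) comm_monoid_add
begin

definition zero_step :: "'a step" where
  "zero_step = NoStep"

fun plus_step :: "'a step \<Rightarrow> 'a step \<Rightarrow> 'a step" where
  "plus_step NoStep v = v"
| "plus_step u NoStep = u"
| "plus_step (Step a) (Step b) = Step (max a b)"

instance
proof
  fix u v w :: "'a step"
  show "u + v + w = u + (v + w)"
    by (cases u; cases v; cases w) (simp_all add: max.assoc)
  show "u + v = v + u"
    by (cases u; cases v) (simp_all add: max.commute)
  show "0 + u = u"
    by (simp add: zero_step_def)
qed

end

lemma step_add_eq_0_iff: "u + v = 0 \<longleftrightarrow> u = 0 \<and> v = 0" for u v :: "'k::linorder step"
  by (cases u; cases v) (simp_all add: zero_step_def)

text \<open>
  A pair of indices stands for the product of a step in \<open>x\<close> and a step in \<open>\<xi>\<close>. Thus the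
  type below is the free \<open>'t\<close>-module on the basis \<open>1, H\<^sub>a(x), H\<^sub>b(\<xi>), H\<^sub>a(x) H\<^sub>b(\<xi>)\<close>, and the
  convolution product of \<open>Poly_Mapping\<close> is the \<open>'t\<close>-bilinear product determined by the addition
  of indices.
\<close>

type_synonym ('k, 't) px_xi = "('k step \<times> 'k step) \<Rightarrow>\<^sub>0 't"

definition px_xi_emb :: "'t::comm_ring_1 \<Rightarrow> ('k::linorder, 't) px_xi" where
  "px_xi_emb t = Poly_Mapping.single (NoStep, NoStep) t"

definition px_xi_hx :: "'k::linorder \<Rightarrow> ('k, 't::comm_ring_1) px_xi" where
  "px_xi_hx a = Poly_Mapping.single (Step a, NoStep) 1"

definition px_xi_hxi :: "'k::linorder \<Rightarrow> ('k, 't::comm_ring_1) px_xi" where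
  "px_xi_hxi a = Poly_Mapping.single (NoStep, Step a) 1"

text \<open>
  The algebra generated over this ring by one element \<open>H(x - \<xi>)\<close> is the quotient of the
  univariate polynomial ring by the ideal (the submodule for multiplication) of the relations.
\<close>

definition p2_relations :: "('k::linorder, 't::comm_ring_1) px_xi poly set" where
  "p2_relations =
     insert ([:0, 1:]\<^sup>2 - [:0, 1:])
       (range (\<lambda>a. [:px_xi_hx a:] * [:0, 1:]
          - ([:px_xi_hxi a:] * [:0, 1:] + [:px_xi_hx a * (1 - px_xi_hxi a):])))"

definition p2_ideal :: "('k::linorder, 't::comm_ring_1) px_xi poly set" where
  "p2_ideal = module.span (*) p2_relations"

lemma module_times: "module ((*) :: 'a::comm_ring_1 \<Rightarrow> 'a \<Rightarrow> 'a)"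
  by unfold_locales (simp_all add: algebra_simps)

lemma p2_ideal_zero: "0 \<in> p2_ideal"
  unfolding p2_ideal_def by (rule module.span_zero[OF module_times])

lemma p2_ideal_add: "p \<in> p2_ideal \<Longrightarrow> q \<in> p2_ideal \<Longrightarrow> p + q \<in> p2_ideal"
  unfolding p2_ideal_def by (rule module.span_add[OF module_times])

lemma p2_ideal_minus: "p \<in> p2_ideal \<Longrightarrow> - p \<in> p2_ideal"
  unfolding p2_ideal_def by (rule module.span_neg[OF module_times])

lemma p2_ideal_mult: "p \<in> p2_ideal \<Longrightarrow> q * p \<in> p2_ideal"
  unfolding p2_ideal_def by (rule module.span_scale[OF module_times])

definition p2_rel ::
  "('k::linorder, 't::comm_ring_1) px_xi poly \<Rightarrow> ('k, 't) px_xi poly \<Rightarrow> bool" where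
  "p2_rel p q \<longleftrightarrow> p - q \<in> p2_ideal"

quotient_type (overloaded) ('k, 't) p2 =
  "('k::linorder, 't::comm_ring_1) px_xi poly" / p2_rel
proof (rule equivpI)
  show "reflp (p2_rel :: ('k, 't) px_xi poly \<Rightarrow> _)"
    by (auto intro!: reflpI simp: p2_rel_def p2_ideal_zero)
  show "symp (p2_rel :: ('k, 't) px_xi poly \<Rightarrow> _)"
  proof (rule sympI)
    fix p q :: "('k, 't) px_xi poly"
    assume "p2_rel p q"
    then show "p2_rel q p"
      using p2_ideal_minus[of "p - q"] by (simp add: p2_rel_def)
  qed
  show "transp (p2_rel :: ('k, 't) px_xi poly \<Rightarrow> _)"
  proof (rule transpI)
    fix p q r :: "('k, 't) px_xi poly"
    assume "p2_rel p q" and "p2_rel q r"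
    then show "p2_rel p r"
      using p2_ideal_add[of "p - q" "q - r"] by (simp add: p2_rel_def)
  qed
qed

text \<open>
  Sending all steps and \<open>H(x - \<xi>)\<close> to zero respects the relations. The resulting ring
  homomorphism onto \<open>'t\<close> shows that the quotient is not the zero ring.
\<close>

definition p2_const :: "('k::linorder, 't::comm_ring_1) px_xi poly \<Rightarrow> 't" where
  "p2_const p = Poly_Mapping.lookup (coeff p 0) 0"

lemma lookup_mult_0:
  fixes p q :: "('k::linorder, 't::comm_ring_1) px_xi"
  shows "Poly_Mapping.lookup (p * q) 0 = Poly_Mapping.lookup p 0 * Poly_Mapping.lookup q 0"
proof -
  have zero_iff: "0 = l + r \<longleftrightarrow> l = 0 \<and> r = 0" for l r :: "'k step \<times> 'k step"
    by (cases l; cases r) (auto simp: zero_prod_def step_add_eq_0_iff eq_commute[of 0])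
  have inner: "(\<Sum>r. Poly_Mapping.lookup q r when 0 = l + r)
      = (Poly_Mapping.lookup q 0 when l = 0)" for l
  proof -
    have "(\<lambda>r. Poly_Mapping.lookup q r when 0 = l + r)
        = (\<lambda>r. (Poly_Mapping.lookup q r when l = 0) when r = 0)"
      by (auto simp: zero_iff when_def)
    then have "(\<Sum>r. Poly_Mapping.lookup q r when 0 = l + r)
        = (\<Sum>r. (Poly_Mapping.lookup q r when l = 0) when r = 0)"
      by (rule arg_cong)
    then show ?thesis
      by (simp only: Sum_any_when_equal)
  qed
  show ?thesis
    by (simp only: lookup_mult inner mult_when Sum_any_when_equal)
qed

lemma lookup_hx_0: "Poly_Mapping.lookup (px_xi_hx a) 0 = 0"
  by (simp add: px_xi_hx_def lookup_single zero_prod_def zero_step_def)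

lemma p2_const_add: "p2_const (p + q) = p2_const p + p2_const q"
  by (simp add: p2_const_def lookup_add)

lemma p2_const_mult: "p2_const (p * q) = p2_const p * p2_const q"
  by (simp add: p2_const_def lookup_mult_0 coeff_mult)

lemma p2_const_ideal:
  assumes "p \<in> p2_ideal"
  shows "p2_const p = 0"
proof -
  have "module.subspace (*) {p. p2_const p = 0}"
    unfolding module.subspace_def[OF module_times]
    by (simp add: p2_const_add p2_const_mult) (simp add: p2_const_def)
  moreover have "p2_relations \<subseteq> {p. p2_const p = 0}"
    by (auto simp: p2_relations_def p2_const_def power2_eq_square lookup_mult_0 lookup_hx_0)
  ultimately have "p2_ideal \<subseteq> {p. p2_const p = 0}"
    unfolding p2_ideal_def by (intro module.span_minimal[OF module_times])
  then show ?thesis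
    using assms by auto
qed

instantiation p2 :: (linorder, comm_ring_1) comm_ring_1
begin

lift_definition zero_p2 :: "('a, 'b) p2" is 0 .

lift_definition one_p2 :: "('a, 'b) p2" is 1 .

lift_definition plus_p2 :: "('a, 'b) p2 \<Rightarrow> ('a, 'b) p2 \<Rightarrow> ('a, 'b) p2" is "(+)"
  unfolding p2_rel_def by (metis p2_ideal_add add_diff_add)

lift_definition uminus_p2 :: "('a, 'b) p2 \<Rightarrow> ('a, 'b) p2" is uminus
  unfolding p2_rel_def by (metis p2_ideal_minus minus_diff_minus)

lift_definition minus_p2 :: "('a, 'b) p2 \<Rightarrow> ('a, 'b) p2 \<Rightarrow> ('a, 'b) p2" is "(-)"
proof -
  fix p p' q q' :: "('a, 'b) px_xi poly"
  assume "p2_rel p p'" and "p2_rel q q'"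
  then have "(p - p') + - (q - q') \<in> p2_ideal"
    unfolding p2_rel_def by (intro p2_ideal_add p2_ideal_minus)
  then show "p2_rel (p - q) (p' - q')"
    by (simp add: p2_rel_def algebra_simps)
qed

lift_definition times_p2 :: "('a, 'b) p2 \<Rightarrow> ('a, 'b) p2 \<Rightarrow> ('a, 'b) p2" is "(*)"
proof -
  fix p p' q q' :: "('a, 'b) px_xi poly"
  assume "p2_rel p p'" and "p2_rel q q'"
  then have "q * (p - p') + p' * (q - q') \<in> p2_ideal"
    unfolding p2_rel_def by (intro p2_ideal_add p2_ideal_mult)
  then show "p2_rel (p * q) (p' * q')"
    by (simp add: p2_rel_def algebra_simps)
qed

instance
proof
  fix u v w :: "('a, 'b) p2"
  have eqI: "p2_rel p q" if "p = q" for p q :: "('a, 'b) px_xi poly"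
    using that by (simp add: p2_rel_def p2_ideal_zero)
  show "u + v + w = u + (v + w)"
    by transfer (rule eqI, simp add: add.assoc)
  show "u + v = v + u"
    by transfer (rule eqI, simp add: add.commute)
  show "0 + u = u"
    by transfer (rule eqI, simp)
  show "- u + u = 0"
    by transfer (rule eqI, simp)
  show "u - v = u + - v"
    by transfer (rule eqI, simp)
  show "u * v * w = u * (v * w)"
    by transfer (rule eqI, simp add: mult.assoc)
  show "u * v = v * u"
    by transfer (rule eqI, simp add: mult.commute)
  show "1 * u = u"
    by transfer (rule eqI, simp)
  show "(u + v) * w = u * w + v * w"
    by transfer (rule eqI, simp add: distrib_right)
  show "(0 :: ('a, 'b) p2) \<noteq> 1"
  proof transfer
    have "p2_const (1 :: ('a, 'b) px_xi poly) = 1"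
      by (simp add: p2_const_def lookup_one)
    then have "p2_const (0 - 1 :: ('a, 'b) px_xi poly) = - 1"
      by (simp add: p2_const_def)
    then show "\<not> p2_rel (0 :: ('a, 'b) px_xi poly) 1"
      using p2_const_ideal[of "0 - 1 :: ('a, 'b) px_xi poly"] by (auto simp: p2_rel_def)
  qed
qed

end

definition p2_of_px_xi :: "('k::linorder, 't::comm_ring_1) px_xi \<Rightarrow> ('k, 't) p2" where
  "p2_of_px_xi r = abs_p2 [:r:]"

definition h_diff :: "('k::linorder, 't::comm_ring_1) p2" where
  "h_diff = abs_p2 [:0, 1:]"

definition p2_emb :: "'t::comm_ring_1 \<Rightarrow> ('k::linorder, 't) p2" where
  "p2_emb t = p2_of_px_xi (px_xi_emb t)"

definition h_x :: "'k::linorder \<Rightarrow> ('k, 't::comm_ring_1) p2" where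
  "h_x a = p2_of_px_xi (px_xi_hx a)"

definition h_xi :: "'k::linorder \<Rightarrow> ('k, 't::comm_ring_1) p2" where
  "h_xi a = p2_of_px_xi (px_xi_hxi a)"

definition fun_x ::
  "('a \<Rightarrow> 'a \<Rightarrow> 't) \<Rightarrow> 'a::comm_ring_1 \<Rightarrow> ('k::linorder, 't::comm_ring_1) p2" where
  "fun_x tens f = p2_emb (tens f 1)"

definition fun_xi ::
  "('a \<Rightarrow> 'a \<Rightarrow> 't) \<Rightarrow> 'a::comm_ring_1 \<Rightarrow> ('k::linorder, 't::comm_ring_1) p2" where
  "fun_xi tens f = p2_emb (tens 1 f)"

definition p2_scale ::
  "('k::linordered_field \<Rightarrow> 't::comm_ring_1 \<Rightarrow> 't) \<Rightarrow> 'k \<Rightarrow> ('k, 't) p2 \<Rightarrow> ('k, 't) p2" where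
  "p2_scale s2 c u = p2_emb (s2 c 1) * u"

section \<open>The integral operators\<close>

definition is_int_p2_x ::
  "('k::linordered_field \<Rightarrow> 'a::comm_ring_1 \<Rightarrow> 'a) \<Rightarrow> ('a \<Rightarrow> 'a) \<Rightarrow> ('k \<Rightarrow> 'a \<Rightarrow> 'a)
     \<Rightarrow> ('k \<Rightarrow> 't::comm_ring_1 \<Rightarrow> 't) \<Rightarrow> ('a \<Rightarrow> 'a \<Rightarrow> 't)
     \<Rightarrow> (('k, 't) p2 \<Rightarrow> ('k, 't) p2) \<Rightarrow> bool" where
  "is_int_p2_x s I S s2 tens J \<longleftrightarrow>
     Vector_Spaces.linear (p2_scale s2) (p2_scale s2) J \<and>
     (\<forall>g u. J (fun_xi tens g * u) = fun_xi tens g * J u) \<and>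
     (\<forall>a u. J (h_xi a * u) = h_xi a * J u) \<and>
     (\<forall>f. J (fun_x tens f) = fun_x tens (I f)) \<and>
     (\<forall>f a. J (fun_x tens f * h_x a) =
        fun_x tens (int_from s I S a f) * h_x a
        + p2_scale s2 (heaviside_bar a * int_from_to s I S 0 a f) 1) \<and>
     (\<forall>f. J (fun_x tens f * h_diff) =
        (fun_x tens (I f) - fun_xi tens (I f)) * h_diff
        + fun_xi tens (I f) * (1 - h_xi 0))"

definition is_int_p2_xi ::
  "('k::linordered_field \<Rightarrow> 'a::comm_ring_1 \<Rightarrow> 'a) \<Rightarrow> ('a \<Rightarrow> 'a) \<Rightarrow> ('k \<Rightarrow> 'a \<Rightarrow> 'a)
     \<Rightarrow> ('k \<Rightarrow> 't::comm_ring_1 \<Rightarrow> 't) \<Rightarrow> ('a \<Rightarrow> 'a \<Rightarrow> 't)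
     \<Rightarrow> (('k, 't) p2 \<Rightarrow> ('k, 't) p2) \<Rightarrow> bool" where
  "is_int_p2_xi s I S s2 tens J \<longleftrightarrow>
     Vector_Spaces.linear (p2_scale s2) (p2_scale s2) J \<and>
     (\<forall>f u. J (fun_x tens f * u) = fun_x tens f * J u) \<and>
     (\<forall>a u. J (h_x a * u) = h_x a * J u) \<and>
     (\<forall>g. J (fun_xi tens g) = fun_xi tens (I g)) \<and>
     (\<forall>g a. J (fun_xi tens g * h_xi a) =
        fun_xi tens (int_from s I S a g) * h_xi a
        + p2_scale s2 (heaviside_bar a * int_from_to s I S 0 a g) 1) \<and>
     (\<forall>g. J (fun_xi tens g * h_diff) =
        (fun_xi tens (I g) - fun_x tens (I g)) * h_diff
        + fun_x tens (I g) * h_x 0)"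

text \<open>
  Each of the two characterizations has exactly one solution under the hypotheses considered here.
  As a module over \<open>'t\<close>, the algebra is free on the steps in \<open>x\<close> and \<open>\<xi>\<close> and their products,
  together with \<open>H(x - \<xi>)\<close> and its multiples by all \<open>H\<^sub>a(\<xi>)\<close>, or alternatively by all \<open>H\<^sub>a(x)\<close>.
  The first basis prescribes the operator in \<open>x\<close>, the second one the operator in \<open>\<xi>\<close>.
\<close>

definition int_p2_x ::
  "('k::linordered_field \<Rightarrow> 'a::comm_ring_1 \<Rightarrow> 'a) \<Rightarrow> ('a \<Rightarrow> 'a) \<Rightarrow> ('k \<Rightarrow> 'a \<Rightarrow> 'a)
     \<Rightarrow> ('k \<Rightarrow> 't::comm_ring_1 \<Rightarrow> 't) \<Rightarrow> ('a \<Rightarrow> 'a \<Rightarrow> 't)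
     \<Rightarrow> ('k, 't) p2 \<Rightarrow> ('k, 't) p2" where
  "int_p2_x s I S s2 tens = (THE J. is_int_p2_x s I S s2 tens J)"

definition int_p2_xi ::
  "('k::linordered_field \<Rightarrow> 'a::comm_ring_1 \<Rightarrow> 'a) \<Rightarrow> ('a \<Rightarrow> 'a) \<Rightarrow> ('k \<Rightarrow> 'a \<Rightarrow> 'a)
     \<Rightarrow> ('k \<Rightarrow> 't::comm_ring_1 \<Rightarrow> 't) \<Rightarrow> ('a \<Rightarrow> 'a \<Rightarrow> 't)
     \<Rightarrow> ('k, 't) p2 \<Rightarrow> ('k, 't) p2" where
  "int_p2_xi s I S s2 tens = (THE J. is_int_p2_xi s I S s2 tens J)"

section \<open>Duplex Rota-Baxter algebras\<close>

definition duplex_rota_baxter ::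
  "('k::field \<Rightarrow> 'a::comm_ring_1 \<Rightarrow> 'a) \<Rightarrow> ('a \<Rightarrow> 'a) \<Rightarrow> ('a \<Rightarrow> 'a) \<Rightarrow> bool" where
  "duplex_rota_baxter s I J \<longleftrightarrow> rota_baxter_algebra s I \<and> rota_baxter_algebra s J"

text \<open>
  \<open>(t, I', J')\<close> extends \<open>(s, I, J)\<close> along \<open>h\<close>: the map \<open>h\<close> is an embedding of algebras, and the
  operators \<open>I'\<close> and \<open>J'\<close> restrict to \<open>I\<close> and \<open>J\<close> on its image.
\<close>

definition duplex_extends ::
  "('k::field \<Rightarrow> 'b::comm_ring_1 \<Rightarrow> 'b) \<Rightarrow> ('b \<Rightarrow> 'b) \<Rightarrow> ('b \<Rightarrow> 'b)
     \<Rightarrow> ('k \<Rightarrow> 'a::comm_ring_1 \<Rightarrow> 'a) \<Rightarrow> ('a \<Rightarrow> 'a) \<Rightarrow> ('a \<Rightarrow> 'a)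
     \<Rightarrow> ('a \<Rightarrow> 'b) \<Rightarrow> bool" where
  "duplex_extends t I' J' s I J h \<longleftrightarrow>
     k_algebra_hom s t h \<and> inj h \<and> (\<forall>u. I' (h u) = h (I u)) \<and> (\<forall>u. J' (h u) = h (J u))"

end

theory Submission
  imports Defs
begin

text \<open>
  Each generator of \<open>\<P>\<^sub>2\<F>\<close> that involves \<open>x\<close> has the form \<open>h\<^sub>p = H(x - p)\<close> for a point \<open>p\<close> that
  does not depend on \<open>x\<close>: the element \<open>1\<close> is the case \<open>p = -\<infinity>\<close>, \<open>H\<^sub>a(x)\<close> is the case \<open>p = a\<close>, and
  \<open>H(x - \<xi>)\<close> is the case \<open>p = \<xi>\<close>. With \<open>F = \<integral>f\<close>, with \<open>F\<^sub>p\<close> the value of \<open>F\<close> at \<open>p\<close> and with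
  \<open>n\<^sub>p\<close> the indicator of \<open>p \<le> 0\<close>, the three formulas that define \<open>I\<^sup>x\<close> are one formula,
    \<open>I\<^sup>x(f h\<^sub>p) = (F - F\<^sub>p) h\<^sub>p + F\<^sub>p n\<^sub>p\<close>.
  The elements \<open>g(\<xi>)\<close>, \<open>H\<^sub>a(\<xi>)\<close>, \<open>F\<^sub>p\<close> and \<open>n\<^sub>p\<close> are constants, in the sense that \<open>I\<^sup>x\<close> commutes
  with multiplication by them.

  The product \<open>h\<^sub>p h\<^sub>q\<close> is the step at the larger of the two points. So it equals
  \<open>c h\<^sub>p + c' h\<^sub>q\<close>, where the constants \<open>c\<close> and \<open>c'\<close> indicate which of the points is the larger
  one; for \<open>p = a\<close> and \<open>q = \<xi>\<close> this is the defining relation of \<open>\<P>\<^sub>2\<F>\<close>. The same constants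
  satisfy \<open>n\<^sub>p n\<^sub>q = c n\<^sub>p + c' n\<^sub>q\<close>, because the larger point is nonpositive iff both points are.
  These two equations and the multiplicativity of evaluation reduce the Rota-Baxter identity for
  \<open>f h\<^sub>p\<close> and \<open>g h\<^sub>q\<close> to a polynomial identity (\<open>step_product_identity\<close>). As the elements
  \<open>f h\<^sub>p\<close> span the algebra over the constants, this gives the identity for all elements.

  The operator \<open>I\<^sup>x\<close> exists because the products \<open>h\<^sub>p\<close>, \<open>h\<^sub>p H\<^sub>b(\<xi>)\<close> form a basis over \<open>\<F>\<^sub>2\<close>. This
  is used as the statement that additive maps may be prescribed on the basis (\<open>p2_free\<close>): an
  explicit map on the polynomial ring, which encodes the rewriting of \<open>H\<^sub>a(x) H(x - \<xi>)\<^sup>n\<close> into basis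
  elements, vanishes on the ideal of relations. The components of \<open>I\<^sup>x\<close> on the tensor square
  come from its universal property.

  The operator \<open>I\<^sup>\<xi>\<close> needs no second computation. Exchanging \<open>x\<close> with \<open>\<xi>\<close>, and \<open>H(x - \<xi>)\<close> with
  \<open>1 - H(x - \<xi>)\<close>, which stands for \<open>H(\<xi> - x)\<close>, preserves the relations and turns the formulas for
  \<open>I\<^sup>x\<close> into those for \<open>I\<^sup>\<xi>\<close>. Hence everything is proved in the locale \<open>piecewise\<close>, which is
  interpreted once for each variable.
\<close>

section \<open>Additive maps on polynomials with step coefficients\<close>

lemma poly_mapping_add_induct [case_names add single]:
  fixes p :: "'a \<Rightarrow>\<^sub>0 'b::comm_monoid_add"
  assumes add: "\<And>p q. P p \<Longrightarrow> P q \<Longrightarrow> P (p + q)"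
    and single: "\<And>k t. P (Poly_Mapping.single k t)"
  shows "P p"
proof (induction p rule: update_induct)
  case const
  show ?case
    using single[of undefined 0] by simp
next
  case (update p k t)
  have "Poly_Mapping.update k t p = p + Poly_Mapping.single k t"
    using update.hyps
    by (intro poly_mapping_eqI)
      (auto simp: lookup_update lookup_add lookup_single in_keys_iff when_def)
  then show ?case
    using add[OF update.IH single] by simp
qed

text \<open>
  The universal map out of a direct sum, for the family \<open>N\<close> of maps on the summands.
\<close>

definition pm_lift :: "('a \<Rightarrow> 'b \<Rightarrow> 'c) \<Rightarrow> ('a \<Rightarrow>\<^sub>0 'b::zero) \<Rightarrow> 'c::comm_monoid_add" where
  "pm_lift N p = Sum_any (\<lambda>k. N k (Poly_Mapping.lookup p k))"

lemma additive_pm_lift: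
  fixes N :: "'a \<Rightarrow> 'b::ab_group_add \<Rightarrow> 'c::ab_group_add"
  assumes "\<And>k. additive (N k)"
  shows "additive (pm_lift N)"
proof
  fix p q
  have fin: "finite {k. N k (Poly_Mapping.lookup p k) \<noteq> 0}" for p
    by (rule finite_subset[OF _ finite_lookup[of p]]) (auto simp: additive.zero[OF assms])
  show "pm_lift N (p + q) = pm_lift N p + pm_lift N q"
    by (simp add: pm_lift_def lookup_add additive.add[OF assms] Sum_any.distrib[OF fin fin])
qed

lemma pm_lift_single:
  assumes "\<And>k. additive (N k)"
  shows "pm_lift N (Poly_Mapping.single k t) = N k t"
proof -
  have "N l (Poly_Mapping.lookup (Poly_Mapping.single k t) l) = (N k t when l = k)" for l
    by (simp add: lookup_single when_def additive.zero[OF assms])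
  then show ?thesis
    by (simp add: pm_lift_def)
qed

lemma px_xi_poly_induct [case_names add monom]:
  fixes p :: "('k::linorder, 't::comm_ring_1) px_xi poly"
  assumes add: "\<And>p q. P p \<Longrightarrow> P q \<Longrightarrow> P (p + q)"
    and monom: "\<And>u v t n. P (monom (Poly_Mapping.single (u, v) t) n)"
  shows "P p"
proof -
  have mon: "P (monom r n)" for r n
    by (induction r rule: poly_mapping_add_induct) (auto simp: add_monom[symmetric] intro: add monom)
  have "P (\<Sum>i\<le>n. monom (coeff p i) i)" for n
    by (induction n) (auto intro: add mon)
  then show ?thesis
    by (metis poly_as_sum_of_monoms)
qed

definition px_xi_poly_lift ::
  "(nat \<Rightarrow> 'k step \<times> 'k step \<Rightarrow> 't \<Rightarrow> 'c) \<Rightarrow> ('k::linorder, 't::comm_ring_1) px_xi poly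
    \<Rightarrow> 'c::ab_group_add" where
  "px_xi_poly_lift N p = Sum_any (\<lambda>n. pm_lift (N n) (coeff p n))"

lemma additive_px_xi_poly_lift:
  assumes "\<And>n k. additive (N n k)"
  shows "additive (px_xi_poly_lift N)"
proof
  fix p q :: "('a, 'b) px_xi poly"
  note add = additive_pm_lift[OF assms]
  have fin: "finite {n. pm_lift (N n) (coeff p n) \<noteq> 0}" for p
    by (rule finite_subset[of _ "{..degree p}"])
      (auto simp: additive.zero[OF add] intro: le_degree)
  show "px_xi_poly_lift N (p + q) = px_xi_poly_lift N p + px_xi_poly_lift N q"
    by (simp add: px_xi_poly_lift_def additive.add[OF add] Sum_any.distrib[OF fin fin])
qed

lemma px_xi_poly_lift_monom:
  assumes "\<And>n k. additive (N n k)"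
  shows "px_xi_poly_lift N (monom (Poly_Mapping.single k t) n) = N n k t"
proof -
  have "pm_lift (N i) (coeff (monom (Poly_Mapping.single k t) n) i) = (N n k t when i = n)" for i
    by (auto simp: when_def additive.zero[OF additive_pm_lift[OF assms]] pm_lift_single[OF assms])
  then show ?thesis
    by (simp add: px_xi_poly_lift_def)
qed

text \<open>
  Additivity alone suffices here, since the multiples of the relations by monomials with arbitrary
  coefficients generate the ideal as an additive group.
\<close>

lemma additive_vanishes_on_p2_ideal:
  assumes "additive J"
    and rel: "\<And>r u v t n. r \<in> p2_relations \<Longrightarrow> J (monom (Poly_Mapping.single (u, v) t) n * r) = 0"
    and "p \<in> p2_ideal"
  shows "J p = 0"
proof -
  interpret additive J by fact
  have gen: "J (q * r) = 0" if "r \<in> p2_relations" for q r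
    by (induction q rule: px_xi_poly_induct) (simp_all add: rel[OF that] add distrib_right)
  show ?thesis
    using \<open>p \<in> p2_ideal\<close> unfolding p2_ideal_def
    by (induction rule: module.span_induct_alt[OF module_times, consumes 1])
      (simp_all add: gen add zero)
qed

section \<open>A basis of the bivariate piecewise extension\<close>

lemma step_plus_cases: "u + v = u \<or> u + v = v" for u v :: "'k::linorder step"
  by (cases u; cases v) (simp_all add: max_def)

text \<open>
  The points at which a step function of the variable \<open>x\<close> can jump. The step at \<open>At NoStep\<close> is the
  constant \<open>1\<close>, so that \<open>At NoStep\<close> plays the role of \<open>-\<infinity>\<close>; the point \<open>Diag\<close> is \<open>\<xi>\<close>.
\<close>

datatype 'k point = At "'k step" | Diag

definition step_x :: "'k::linorder step \<Rightarrow> ('k, 't::comm_ring_1) p2" where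
  "step_x u = p2_of_px_xi (Poly_Mapping.single (u, NoStep) 1)"

definition step_xi :: "'k::linorder step \<Rightarrow> ('k, 't::comm_ring_1) p2" where
  "step_xi v = p2_of_px_xi (Poly_Mapping.single (NoStep, v) 1)"

lemma abs_p2_eqI: "p - q \<in> p2_ideal \<Longrightarrow> abs_p2 p = abs_p2 q"
  by (simp add: p2.abs_eq_iff p2_rel_def)

lemma abs_p2_mult: "abs_p2 (p * q) = abs_p2 p * abs_p2 q"
  and abs_p2_add: "abs_p2 (p + q) = abs_p2 p + abs_p2 q"
  and abs_p2_diff: "abs_p2 (p - q) = abs_p2 p - abs_p2 q"
  by (simp_all add: times_p2.abs_eq plus_p2.abs_eq minus_p2.abs_eq)

lemma p2_of_px_xi_mult: "p2_of_px_xi (p * q) = p2_of_px_xi p * p2_of_px_xi q"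
  and p2_of_px_xi_add: "p2_of_px_xi (p + q) = p2_of_px_xi p + p2_of_px_xi q"
  and p2_of_px_xi_diff: "p2_of_px_xi (p - q) = p2_of_px_xi p - p2_of_px_xi q"
  and p2_of_px_xi_1: "p2_of_px_xi 1 = 1"
  by (simp_all add: p2_of_px_xi_def abs_p2_mult[symmetric] abs_p2_add[symmetric]
      abs_p2_diff[symmetric] one_p2.abs_eq one_pCons mult.commute)

lemma single_NoStep:
  "Poly_Mapping.single (NoStep, NoStep) (1::'t::comm_ring_1) = (1 :: ('k::linorder, 't) px_xi)"
  by (simp add: zero_step_def[symmetric] zero_prod_def[symmetric])

lemma p2_emb_mult: "p2_emb (a * b) = p2_emb a * p2_emb b"
  and p2_emb_add: "p2_emb (a + b) = p2_emb a + p2_emb b"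
  and p2_emb_1: "p2_emb 1 = 1"
proof -
  show "p2_emb (a * b) = p2_emb a * p2_emb b"
    by (simp add: p2_emb_def px_xi_emb_def p2_of_px_xi_mult[symmetric] mult_single)
  show "p2_emb (a + b) = p2_emb a + p2_emb b"
    by (simp add: p2_emb_def px_xi_emb_def p2_of_px_xi_add[symmetric] single_add)
  show "p2_emb 1 = 1"
    by (simp add: p2_emb_def px_xi_emb_def single_NoStep p2_of_px_xi_1)
qed

lemma additive_p2_emb: "additive p2_emb"
  by (simp add: additive_def p2_emb_add)

lemma step_x_0: "step_x 0 = 1" and step_xi_0: "step_xi 0 = 1"
  by (simp_all add: step_x_def step_xi_def zero_step_def single_NoStep p2_of_px_xi_1)

lemma step_x_add: "step_x (u + v) = step_x u * step_x v"
  and step_xi_add: "step_xi (u + v) = step_xi u * step_xi v"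
  by (simp_all add: step_x_def step_xi_def p2_of_px_xi_mult[symmetric] mult_single)

lemma h_diff_idem: "h_diff * h_diff = (h_diff :: ('k::linorder, 't::comm_ring_1) p2)"
proof -
  have "[:0, 1:]\<^sup>2 - [:0, 1:] \<in> (p2_ideal :: ('k, 't) px_xi poly set)"
    unfolding p2_ideal_def p2_relations_def by (rule module.span_base[OF module_times]) simp
  then have "abs_p2 ([:0, 1:]\<^sup>2) = (abs_p2 [:0, 1:] :: ('k, 't) p2)"
    by (rule abs_p2_eqI)
  then show ?thesis
    by (simp only: h_diff_def abs_p2_mult power2_eq_square)
qed

lemma step_x_h_diff:
  "step_x u * h_diff = step_xi u * h_diff + step_x u * (1 - step_xi u)"
proof (cases u)
  case NoStep
  then show ?thesis
    by (simp add: zero_step_def[symmetric] step_x_0 step_xi_0)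
next
  case (Step a)
  have "[:px_xi_hx a:] * [:0, 1:]
      - ([:px_xi_hxi a:] * [:0, 1:] + [:px_xi_hx a * (1 - px_xi_hxi a):]) \<in> p2_ideal"
    unfolding p2_ideal_def p2_relations_def by (rule module.span_base[OF module_times]) blast
  then have "abs_p2 ([:px_xi_hx a:] * [:0, 1:])
      = abs_p2 ([:px_xi_hxi a:] * [:0, 1:] + [:px_xi_hx a * (1 - px_xi_hxi a):])"
    by (rule abs_p2_eqI)
  then show ?thesis
    by (simp only: abs_p2_mult abs_p2_add Step step_x_def step_xi_def px_xi_hx_def px_xi_hxi_def
        h_diff_def p2_of_px_xi_def[symmetric] p2_of_px_xi_mult p2_of_px_xi_diff p2_of_px_xi_1)
qed

lemma p2_of_px_xi_single:
  "p2_of_px_xi (Poly_Mapping.single (u, v) t) = p2_emb t * step_x u * step_xi v"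
  by (simp add: p2_emb_def px_xi_emb_def step_x_def step_xi_def p2_of_px_xi_mult[symmetric]
      mult_single zero_step_def[symmetric])

lemma abs_p2_monom: "abs_p2 (monom r n) = p2_of_px_xi r * h_diff ^ n"
proof (induction n)
  case 0
  show ?case
    by (simp add: p2_of_px_xi_def monom_0)
next
  case (Suc n)
  have "monom r (Suc n) = [:0, 1:] * monom r n"
    by (simp add: monom_Suc)
  then show ?case
    by (simp only: abs_p2_mult Suc.IH h_diff_def[symmetric]) (simp add: ac_simps)
qed

fun p2_point :: "'k::linorder point \<Rightarrow> ('k, 't::comm_ring_1) p2" where
  "p2_point (At u) = step_x u"
| "p2_point Diag = h_diff"

text \<open>
  The basis elements span: idempotence reduces every positive power of \<open>H(x - \<xi>)\<close> to the first
  power, and the mixed relation then removes the step in \<open>x\<close> next to it.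
\<close>

lemma p2_point_induct [case_names add gen]:
  fixes w :: "('k::linorder, 't::comm_ring_1) p2"
  assumes add: "\<And>u v. P u \<Longrightarrow> P v \<Longrightarrow> P (u + v)"
    and gen: "\<And>t p v. P (p2_emb t * p2_point p * step_xi v)"
  shows "P w"
proof -
  have "P (abs_p2 q)" for q
  proof (induction q rule: px_xi_poly_induct)
    case (add p q)
    then show ?case
      by (simp add: abs_p2_add assms(1))
  next
    case (monom u v t n)
    show ?case
    proof (cases n)
      case 0
      then show ?thesis
        using gen[of t "At u" v] by (simp add: abs_p2_monom p2_of_px_xi_single)
    next
      case (Suc m)
      have "h_diff ^ Suc m = (h_diff :: ('k, 't) p2)"
        by (induction m) (simp_all add: h_diff_idem)
      then have "abs_p2 (monom (Poly_Mapping.single (u, v) t) n)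
          = p2_emb t * (step_x u * h_diff) * step_xi v"
        by (simp add: abs_p2_monom p2_of_px_xi_single Suc ac_simps del: power_Suc)
      also have "\<dots> = p2_emb t * h_diff * step_xi (u + v)
          + (p2_emb t * step_x u * step_xi v + p2_emb (- t) * step_x u * step_xi (u + v))"
      proof -
        have "p2_emb (- t) = - (p2_emb t :: ('k, 't) p2)"
          by (rule additive.minus[OF additive_p2_emb])
        then show ?thesis
          unfolding step_x_h_diff step_xi_add by (simp add: algebra_simps)
      qed
      also have "P \<dots>"
        using gen[of t Diag] gen[of _ "At u"] by (intro add) simp_all
      finally show ?thesis .
    qed
  qed
  then show ?thesis
    by (metis p2.abs_eq_iff Quotient3_abs_rep[OF Quotient3_p2])
qed

text \<open>
  Linear independence of the basis over \<open>\<F>\<^sub>2\<close>, in the form in which it is used: an additive map can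
  be prescribed on all multiples of the basis elements. A monomial
  \<open>t H\<^sub>u(x) H\<^sub>v(\<xi>) H(x - \<xi>)\<^sup>n\<close> with \<open>n > 0\<close> is equal in the quotient to
  \<open>t (H\<^sub>u\<^sub>+\<^sub>v(\<xi>) H(x - \<xi>) + H\<^sub>u(x) H\<^sub>v(\<xi>) - H\<^sub>u(x) H\<^sub>u\<^sub>+\<^sub>v(\<xi>))\<close>, and this forces the values
  on monomials. The induced map kills the relations because \<open>u + v\<close> is always one of \<open>u\<close> and \<open>v\<close>.
\<close>

lemma p2_free:
  fixes m :: "'k::linorder point \<Rightarrow> 'k step \<Rightarrow> 't::comm_ring_1 \<Rightarrow> 'c::ab_group_add"
  assumes add: "\<And>p v. additive (m p v)"
  obtains J :: "('k, 't) p2 \<Rightarrow> 'c" where "additive J"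
    and "\<And>t p v. J (p2_emb t * p2_point p * step_xi v) = m p v t"
proof -
  define N where "N n = (\<lambda>(u, v) t. if n = 0 then m (At u) v t
      else m Diag (u + v) t + m (At u) v t - m (At u) (u + v) t)" for n :: nat
  have N: "additive (N n k)" for n k
    by (cases k) (auto simp: N_def additive_def additive.add[OF add])
  define L where "L = px_xi_poly_lift N"
  interpret L: additive L
    unfolding L_def by (rule additive_px_xi_poly_lift[OF N])
  have L_monom: "L (monom (Poly_Mapping.single (u, v) t) n) = N n (u, v) t" for u v t n
    by (simp add: L_def px_xi_poly_lift_monom[OF N])
  have L_rel: "L (monom (Poly_Mapping.single (u, v) t) n * r) = 0"
    if "r \<in> p2_relations" for r u v t n
  proof -
    from that consider "r = [:0, 1:]\<^sup>2 - [:0, 1:]"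
      | a where "r = [:px_xi_hx a:] * [:0, 1:]
          - ([:px_xi_hxi a:] * [:0, 1:] + [:px_xi_hx a * (1 - px_xi_hxi a):])"
      by (auto simp: p2_relations_def)
    then show ?thesis
    proof cases
      case 1
      have "r = monom 1 2 - monom 1 1"
        by (simp add: 1 monom_altdef power2_eq_square)
      then show ?thesis
        by (simp add: right_diff_distrib mult_monom L.diff L_monom N_def)
    next
      case (2 a)
      have hx_hxi: "px_xi_hx a * (1 - px_xi_hxi a)
          = Poly_Mapping.single (Step a, NoStep) (1::'t) - Poly_Mapping.single (Step a, Step a) 1"
        by (simp add: px_xi_hx_def px_xi_hxi_def right_diff_distrib mult_single)
      have "r = monom (Poly_Mapping.single (Step a, NoStep) 1) 1
          - monom (Poly_Mapping.single (NoStep, Step a) 1) 1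
          - monom (Poly_Mapping.single (Step a, NoStep) 1) 0
          + monom (Poly_Mapping.single (Step a, Step a) 1) 0"
        unfolding 2 hx_hxi by (simp add: px_xi_hx_def px_xi_hxi_def monom_0 monom_Suc)
      then have "L (monom (Poly_Mapping.single (u, v) t) n * r)
          = N (Suc n) (u + Step a, v) t - N (Suc n) (u, v + Step a) t
            - N n (u + Step a, v) t + N n (u + Step a, v + Step a) t"
        by (simp add: distrib_left right_diff_distrib mult_monom mult_single L.diff L.add L_monom
            zero_step_def[symmetric])
      also have "\<dots> = 0"
      proof -
        consider "u + Step a = u" | "u + Step a = Step a"
          using step_plus_cases by blast
        then show ?thesis
        proof cases
          case 1
          then have "u + (v + Step a) = u + v"
            by (metis add.assoc add.commute)
          with 1 show ?thesis
            by (simp add: N_def ac_simps)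
        next
          case 2
          then have "u + (v + Step a) = v + Step a"
            by (metis add.assoc add.commute)
          with 2 show ?thesis
            by (simp add: N_def ac_simps)
        qed
      qed
      finally show ?thesis .
    qed
  qed
  define J where "J w = L (rep_p2 w)" for w
  have J_abs: "J (abs_p2 p) = L p" for p
  proof -
    have "p2_rel (rep_p2 (abs_p2 p)) p"
      using Quotient3_rep_abs[OF Quotient3_p2] by (simp add: p2_rel_def p2_ideal_zero)
    then have "rep_p2 (abs_p2 p) - p \<in> p2_ideal"
      by (simp add: p2_rel_def)
    with L.additive_axioms L_rel have "L (rep_p2 (abs_p2 p) - p) = 0"
      by (rule additive_vanishes_on_p2_ideal)
    then show ?thesis
      by (simp add: J_def L.diff)
  qed
  show thesis
  proof
    show "additive J"
    proof
      fix v w :: "('k, 't) p2"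
      show "J (v + w) = J v + J w"
        by (metis J_abs J_def L.add abs_p2_add Quotient3_abs_rep[OF Quotient3_p2])
    qed
    fix t p v
    show "J (p2_emb t * p2_point p * step_xi v) = m p v t"
    proof (cases p)
      case (At u)
      then have "p2_emb t * p2_point p * step_xi v = abs_p2 (monom (Poly_Mapping.single (u, v) t) 0)"
        by (simp add: abs_p2_monom p2_of_px_xi_single)
      then show ?thesis
        by (simp add: J_abs L_monom N_def At)
    next
      case Diag
      then have "p2_emb t * p2_point p * step_xi v
          = abs_p2 (monom (Poly_Mapping.single (0, v) t) 1)"
        by (simp add: abs_p2_monom p2_of_px_xi_single step_x_0 ac_simps)
      then show ?thesis
        by (simp add: J_abs L_monom N_def Diag)
    qed
  qed
qed

lemma h_x_eq: "h_x a = step_x (Step a)" and h_xi_eq: "h_xi a = step_xi (Step a)"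
  by (simp_all add: h_x_def h_xi_def step_x_def step_xi_def px_xi_hx_def px_xi_hxi_def)

section \<open>Evaluation in ordinary shifted Rota-Baxter algebras\<close>

locale k_algebra_ops =
  fixes s :: "'k::field \<Rightarrow> 'a::comm_ring_1 \<Rightarrow> 'a"
  assumes alg: "k_algebra s"
begin

sublocale vector_space s
  using alg by (simp add: k_algebra_def)

lemma scale_mult_left: "s c (x * y) = s c x * y"
  using alg by (simp add: k_algebra_def)

lemma scale_mult_right: "s c (x * y) = x * s c y"
  using scale_mult_left[of c y x] by (simp add: mult.commute)

lemma scale_as_mult: "s c x = s c 1 * x"
  using scale_mult_left[of c 1 x] by simp

end

locale ordinary_shifted =
  fixes s :: "'k::linordered_field \<Rightarrow> 'f::comm_ring_1 \<Rightarrow> 'f"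
    and I :: "'f \<Rightarrow> 'f"
    and S :: "'k \<Rightarrow> 'f \<Rightarrow> 'f"
  assumes ordinary: "ordinary_rota_baxter s I"
    and shifted: "shifted_rota_baxter s I S"
begin

sublocale k_algebra_ops s
  using ordinary by unfold_locales (simp add: ordinary_rota_baxter_def rota_baxter_algebra_def)

lemma I_add: "I (f + g) = I f + I g"
  and I_scale: "I (s c f) = s c (I f)"
  and I_mult: "I f * I g = I (f * I g) + I (g * I f)"
  using ordinary
  by (simp_all add: ordinary_rota_baxter_def rota_baxter_algebra_def Vector_Spaces.linear_iff)

lemma decomposition: obtains g c where "f = I g + s c 1"
  using ordinary unfolding ordinary_rota_baxter_def by blast

lemma eval_proj_eq: "eval_proj s I (I g + s c 1) = c"
  unfolding eval_proj_def
proof (rule the_equality)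
  fix d
  assume "\<exists>h. I g + s c 1 = I h + s d 1"
  then obtain h where eq: "I g + s c 1 = I h + s d 1"
    by blast
  have diff: "I (g - h) = I g - I h"
    by (rule additive.diff) (simp add: additive_def I_add)
  have "I (g - h) = s (d - c) 1"
    unfolding diff scale_left_diff_distrib using eq by (simp add: algebra_simps)
  then have "s (d - c) 1 \<in> range I"
    by (rule range_eqI[OF sym])
  then have "s (d - c) 1 \<in> range I \<inter> range (\<lambda>c. s c 1)"
    by blast
  then have "s (d - c) 1 = 0"
    using ordinary unfolding ordinary_rota_baxter_def by blast
  then show "d = c"
    by simp
qed blast

text \<open>
  Multiplicativity holds because the Rota-Baxter identity makes the image of the integral closed
  under multiplication: it is an ideal that complements the scalars.
\<close>

lemma eval_proj_add: "eval_proj s I (f + g) = eval_proj s I f + eval_proj s I g"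
  and eval_proj_scale: "eval_proj s I (s c f) = c * eval_proj s I f"
  and eval_proj_mult: "eval_proj s I (f * g) = eval_proj s I f * eval_proj s I g"
proof -
  obtain f' a where f: "f = I f' + s a 1"
    by (rule decomposition)
  obtain g' b where g: "g = I g' + s b 1"
    by (rule decomposition)
  have "f + g = I (f' + g') + s (a + b) 1"
    by (simp add: f g I_add scale_left_distrib)
  then show "eval_proj s I (f + g) = eval_proj s I f + eval_proj s I g"
    by (simp only: eval_proj_eq f g)
  have "s c f = I (s c f') + s (c * a) 1"
    by (simp add: f I_scale scale_right_distrib)
  then show "eval_proj s I (s c f) = c * eval_proj s I f"
    by (simp only: eval_proj_eq f)
  have "f * g = I (f' * I g' + g' * I f' + s b f' + s a g') + s (a * b) 1"
    by (simp add: f g I_add I_scale I_mult[symmetric] distrib_left distrib_right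
        scale_right_distrib scale_mult_left[symmetric] scale_mult_right[symmetric] mult.commute)
  then show "eval_proj s I (f * g) = eval_proj s I f * eval_proj s I g"
    by (simp only: eval_proj_eq f g)
qed

lemma eval_at_add: "eval_at s I S c (f + g) = eval_at s I S c f + eval_at s I S c g"
  and eval_at_scale: "eval_at s I S c (s d f) = d * eval_at s I S c f"
  and eval_at_mult: "eval_at s I S c (f * g) = eval_at s I S c f * eval_at s I S c g"
proof -
  have S: "S c (f + g) = S c f + S c g" "S c (s d f) = s d (S c f)"
    "S c (f * g) = S c f * S c g" for f g
    using shifted
    by (simp_all add: shifted_rota_baxter_def k_algebra_hom_def Vector_Spaces.linear_iff)
  show "eval_at s I S c (f + g) = eval_at s I S c f + eval_at s I S c g"
    "eval_at s I S c (s d f) = d * eval_at s I S c f"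
    "eval_at s I S c (f * g) = eval_at s I S c f * eval_at s I S c g"
    by (simp_all add: eval_at_def S eval_proj_add eval_proj_scale eval_proj_mult)
qed

text \<open>
  The shift by \<open>0\<close> is idempotent and injective, hence the identity, and the projector vanishes on
  the image of the integral.
\<close>

lemma eval_at_0_I: "eval_at s I S 0 (I f) = 0"
proof -
  have "inj (S 0)" and "S (0 + 0) = S 0 \<circ> S 0"
    using shifted unfolding shifted_rota_baxter_def by (blast intro: bij_is_inj)+
  then have "S 0 (S 0 (I f)) = S 0 (I f)"
    by (simp add: comp_def fun_eq_iff)
  with \<open>inj (S 0)\<close> have "S 0 (I f) = I f"
    by (rule injD)
  then show ?thesis
    using eval_proj_eq[of f 0] by (simp add: eval_at_def)
qed

lemma int_from_to_0: "int_from_to s I S 0 a f = eval_at s I S a (I f)"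
  by (simp add: int_from_to_def int_from_def eval_at_0_I)

end

section \<open>The universal property and the symmetry of the tensor square\<close>

lemma lookup_free_scale: "Poly_Mapping.lookup (free_scale c p) x = c * Poly_Mapping.lookup p x"
  by (simp add: free_scale_def Poly_Mapping.map.rep_eq when_def)

lemma free_scale_add: "free_scale c (p + q) = free_scale c p + free_scale c q"
  by (intro poly_mapping_eqI) (simp add: lookup_free_scale lookup_add distrib_left)

lemma free_scale_single: "free_scale c (Poly_Mapping.single x d) = Poly_Mapping.single x (c * d)"
  by (intro poly_mapping_eqI) (simp add: lookup_free_scale lookup_single when_def)

lemma module_free_scale: "module free_scale"
  by unfold_locales
    (auto intro!: poly_mapping_eqI simp: lookup_free_scale lookup_add algebra_simps)

lemma tensor_eval_altdef:
  assumes "vector_space sc"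
  shows "tensor_eval sc b p = pm_lift (\<lambda>x c. sc c (b (fst x) (snd x))) p"
proof -
  interpret vector_space sc by fact
  show ?thesis
    unfolding tensor_eval_def pm_lift_def
    by (intro Sum_any.expand_superset[symmetric]) (auto simp: in_keys_iff)
qed

context
  fixes sc :: "'k::field \<Rightarrow> 'v::comm_ring_1 \<Rightarrow> 'v"
  assumes vs: "vector_space sc"
begin

interpretation vector_space sc by (rule vs)

lemma additive_tensor_eval: "additive (tensor_eval sc b)"
  unfolding tensor_eval_altdef[OF vs, abs_def]
  by (rule additive_pm_lift) (simp add: additive_def scale_left_distrib)

lemma tensor_eval_single: "tensor_eval sc b (Poly_Mapping.single x c) = sc c (b (fst x) (snd x))"
  unfolding tensor_eval_altdef[OF vs]
  by (rule pm_lift_single) (simp add: additive_def scale_left_distrib)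

lemma tensor_eval_scale: "tensor_eval sc b (free_scale c p) = sc c (tensor_eval sc b p)"
proof -
  interpret ev: additive "tensor_eval sc b"
    by (rule additive_tensor_eval)
  show ?thesis
  proof (induction p rule: poly_mapping_add_induct)
    case (add p q)
    then show ?case
      by (simp add: free_scale_add ev.add scale_right_distrib)
  next
    case (single k t)
    show ?case
      by (simp add: free_scale_single tensor_eval_single)
  qed
qed

end

locale tensor_square_alg =
  fixes s :: "'k::field \<Rightarrow> 'f::comm_ring_1 \<Rightarrow> 'f"
    and s2 :: "'k \<Rightarrow> 't::comm_ring_1 \<Rightarrow> 't"
    and tens :: "'f \<Rightarrow> 'f \<Rightarrow> 't"
  assumes tensor: "tensor_square s s2 tens"
begin

sublocale T: k_algebra_ops s2
  using tensor by unfold_locales (simp add: tensor_square_def)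

lemma tens_1: "tens 1 1 = 1"
  and tens_mult: "tens f g * tens f' g' = tens (f * f') (g * g')"
  using tensor by (simp_all add: tensor_square_def)

lemma tensor_eval_zero_iff:
  "tensor_eval s2 tens p = 0 \<longleftrightarrow> p \<in> module.span free_scale (tensor_relations s)"
  using tensor unfolding tensor_square_def by blast

lemma tens_relations:
  shows tens_add_left: "tens (f + f') g = tens f g + tens f' g"
    and tens_add_right: "tens f (g + g') = tens f g + tens f g'"
    and tens_scale_left: "tens (s c f) g = s2 c (tens f g)"
    and tens_scale_right: "tens f (s c g) = s2 c (tens f g)"
proof -
  interpret ev: additive "tensor_eval s2 tens"
    by (rule additive_tensor_eval) unfold_locales
  have zero: "tensor_eval s2 tens p = 0" if "p \<in> tensor_relations s" for p
    unfolding tensor_eval_zero_iff using that by (rule module.span_base[OF module_free_scale])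
  note [simp] = ev.add ev.diff tensor_eval_single[OF T.vector_space_axioms]
  have "Poly_Mapping.single (f + f', g) 1 - Poly_Mapping.single (f, g) 1
      - Poly_Mapping.single (f', g) 1 \<in> tensor_relations s"
    unfolding tensor_relations_def by blast
  from zero[OF this] show "tens (f + f') g = tens f g + tens f' g"
    by (simp add: algebra_simps)
  have "Poly_Mapping.single (f, g + g') 1 - Poly_Mapping.single (f, g) 1
      - Poly_Mapping.single (f, g') 1 \<in> tensor_relations s"
    unfolding tensor_relations_def by blast
  from zero[OF this] show "tens f (g + g') = tens f g + tens f g'"
    by (simp add: algebra_simps)
  have "Poly_Mapping.single (s c f, g) 1 - Poly_Mapping.single (f, g) c \<in> tensor_relations s"
    unfolding tensor_relations_def by blast
  from zero[OF this] show "tens (s c f) g = s2 c (tens f g)"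
    by simp
  have "Poly_Mapping.single (f, s c g) 1 - Poly_Mapping.single (f, g) c \<in> tensor_relations s"
    unfolding tensor_relations_def by blast
  from zero[OF this] show "tens f (s c g) = s2 c (tens f g)"
    by simp
qed

lemma tensor_induct [case_names add tens]:
  assumes add: "\<And>t t'. P t \<Longrightarrow> P t' \<Longrightarrow> P (t + t')" and tens: "\<And>f g. P (tens f g)"
  shows "P t"
proof -
  interpret ev: additive "tensor_eval s2 tens"
    by (rule additive_tensor_eval) unfold_locales
  have "P (tensor_eval s2 tens p)" for p
    by (induction p rule: poly_mapping_add_induct)
      (simp_all add: ev.add add tensor_eval_single[OF T.vector_space_axioms]
        tens_scale_left[symmetric] tens)
  moreover have "surj (tensor_eval s2 tens)"
    using tensor by (simp add: tensor_square_def)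
  ultimately show ?thesis
    by (metis surjD)
qed

text \<open>
  A balanced bilinear map kills the relations, hence factors through the
  quotient of the free module by their span.
\<close>

lemma tensor_universal:
  fixes sc :: "'k \<Rightarrow> 'v::comm_ring_1 \<Rightarrow> 'v" and b :: "'f \<Rightarrow> 'f \<Rightarrow> 'v"
  assumes vs: "vector_space sc"
    and add_left: "\<And>f f' g. b (f + f') g = b f g + b f' g"
    and add_right: "\<And>f g g'. b f (g + g') = b f g + b f g'"
    and scale_left: "\<And>c f g. b (s c f) g = sc c (b f g)"
    and scale_right: "\<And>c f g. b f (s c g) = sc c (b f g)"
  obtains L where "Vector_Spaces.linear s2 sc L" and "\<And>f g. L (tens f g) = b f g"
proof -
  interpret V: vector_space sc by fact
  interpret ev: additive "tensor_eval s2 tens"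
    by (rule additive_tensor_eval) unfold_locales
  interpret evb: additive "tensor_eval sc b"
    by (rule additive_tensor_eval[OF vs])
  note [simp] = tensor_eval_single[OF vs]
  have kernel: "tensor_eval sc b p = 0" if "tensor_eval s2 tens p = 0" for p
  proof -
    have base: "tensor_eval sc b r = 0" if "r \<in> tensor_relations s" for r
      using that
      by (auto simp: tensor_relations_def evb.diff add_left add_right scale_left scale_right)
    from that have "p \<in> module.span free_scale (tensor_relations s)"
      by (simp add: tensor_eval_zero_iff)
    then show ?thesis
      by (induction rule: module.span_induct_alt[OF module_free_scale, consumes 1])
        (simp_all add: evb.zero evb.add base tensor_eval_scale[OF vs])
  qed
  define rep where "rep = inv (tensor_eval s2 tens)"
  have rep: "tensor_eval s2 tens (rep t) = t" for t
    using tensor by (simp add: rep_def tensor_square_def surj_f_inv_f)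
  define L where "L t = tensor_eval sc b (rep t)" for t
  have L: "L (tensor_eval s2 tens p) = tensor_eval sc b p" for p
  proof -
    have "tensor_eval sc b (rep (tensor_eval s2 tens p) - p) = 0"
      by (rule kernel) (simp add: ev.diff rep)
    then show ?thesis
      by (simp add: L_def evb.diff)
  qed
  show thesis
  proof
    have "L (t + t') = L t + L t'" for t t'
      using L[of "rep t + rep t'"] by (simp add: ev.add evb.add rep L_def)
    moreover have "L (s2 c t) = sc c (L t)" for c t
      using L[of "free_scale c (rep t)"]
      by (simp add: tensor_eval_scale[OF vs] tensor_eval_scale[OF T.vector_space_axioms] rep L_def)
    ultimately show "Vector_Spaces.linear s2 sc L"
      by (simp add: Vector_Spaces.linear_iff vs T.vector_space_axioms)
    show "L (tens f g) = b f g" for f g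
      using L[of "Poly_Mapping.single (f, g) 1"]
      by (simp add: tensor_eval_single[OF T.vector_space_axioms])
  qed
qed

end

text \<open>
  The set of bilinearity relations is symmetric, so exchanging the two factors gives the tensor
  square again. This is what lets the second variable play the role of the first.
\<close>

lemma tensor_square_swap:
  fixes s :: "'k::field \<Rightarrow> 'f::comm_ring_1 \<Rightarrow> 'f"
  assumes "tensor_square s s2 tens"
  shows "tensor_square s s2 (\<lambda>f g. tens g f)"
proof -
  interpret tensor_square_alg s s2 tens
    using assms by unfold_locales
  note vs = T.vector_space_axioms
  let ?snet = "\<lambda>f g. tens g f"
  let ?R = "tensor_relations s"
  let ?span = "module.span (free_scale :: 'k \<Rightarrow> ('f \<times> 'f \<Rightarrow>\<^sub>0 'k) \<Rightarrow> _)"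
  define swap :: "('f \<times> 'f \<Rightarrow>\<^sub>0 'k) \<Rightarrow> 'f \<times> 'f \<Rightarrow>\<^sub>0 'k"
    where "swap = pm_lift (\<lambda>x. Poly_Mapping.single (prod.swap x))"
  have additive_single: "additive (Poly_Mapping.single x :: 'k \<Rightarrow> _)" for x :: "'f \<times> 'f"
    by (simp add: additive_def single_add)
  interpret sw: additive swap
    unfolding swap_def by (rule additive_pm_lift[OF additive_single])
  have swap_single: "swap (Poly_Mapping.single x c) = Poly_Mapping.single (prod.swap x) c" for x c
    unfolding swap_def by (rule pm_lift_single[OF additive_single])
  have swap_swap: "swap (swap p) = p" for p
    by (induction p rule: poly_mapping_add_induct) (simp_all add: sw.add swap_single)
  have swap_scale: "swap (free_scale c p) = free_scale c (swap p)" for c p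
    by (induction p rule: poly_mapping_add_induct)
      (simp_all add: sw.add swap_single free_scale_add free_scale_single)
  have swap_eval: "tensor_eval s2 tens (swap p) = tensor_eval s2 ?snet p" for p
    by (induction p rule: poly_mapping_add_induct)
      (simp_all add: sw.add additive.add[OF additive_tensor_eval[OF vs]] swap_single
        tensor_eval_single[OF vs])
  have swap_rel: "swap r \<in> ?R" if "r \<in> ?R" for r
  proof -
    let ?s = "\<lambda>f g. Poly_Mapping.single (f, g) :: 'k \<Rightarrow> _"
    from that consider
        f f' g where "r = ?s (f + f') g 1 - ?s f g 1 - ?s f' g 1"
      | f g g' where "r = ?s f (g + g') 1 - ?s f g 1 - ?s f g' 1"
      | c f g where "r = ?s (s c f) g 1 - ?s f g c"
      | c f g where "r = ?s f (s c g) 1 - ?s f g c"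
      unfolding tensor_relations_def by blast
    then show ?thesis
    proof cases
      case (1 f f' g)
      then have "swap r = ?s g (f + f') 1 - ?s g f 1 - ?s g f' 1"
        by (simp only: sw.diff swap_single swap_simp)
      then show ?thesis
        unfolding tensor_relations_def by blast
    next
      case (2 f g g')
      then have "swap r = ?s (g + g') f 1 - ?s g f 1 - ?s g' f 1"
        by (simp only: sw.diff swap_single swap_simp)
      then show ?thesis
        unfolding tensor_relations_def by blast
    next
      case (3 c f g)
      then have "swap r = ?s g (s c f) 1 - ?s g f c"
        by (simp only: sw.diff swap_single swap_simp)
      then show ?thesis
        unfolding tensor_relations_def by blast
    next
      case (4 c f g)
      then have "swap r = ?s (s c g) f 1 - ?s g f c"
        by (simp only: sw.diff swap_single swap_simp)
      then show ?thesis
        unfolding tensor_relations_def by blast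
    qed
  qed
  have swap_span: "swap p \<in> ?span ?R" if "p \<in> ?span ?R" for p
    using that
    by (induction rule: module.span_induct_alt[OF module_free_scale, consumes 1])
      (simp_all add: sw.zero sw.add swap_scale swap_rel module.span_zero[OF module_free_scale]
        module.span_add[OF module_free_scale] module.span_scale[OF module_free_scale]
        module.span_base[OF module_free_scale])
  have "tensor_eval s2 ?snet p = 0 \<longleftrightarrow> p \<in> ?span ?R" for p
    unfolding swap_eval[symmetric] tensor_eval_zero_iff using swap_span swap_swap by metis
  then have kernel: "{p. tensor_eval s2 ?snet p = 0} = ?span ?R"
    by blast
  have "surj (tensor_eval s2 ?snet)"
  proof (rule surjI)
    have "surj (tensor_eval s2 tens)"
      using tensor by (simp add: tensor_square_def)
    then show "tensor_eval s2 ?snet (swap (inv (tensor_eval s2 tens) t)) = t" for t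
      by (simp add: swap_eval[symmetric] swap_swap surj_f_inv_f)
  qed
  then show ?thesis
    using assms by (simp add: tensor_square_def kernel)
qed

section \<open>Integration of step functions in one variable\<close>

text \<open>
  The algebraic core of the Rota-Baxter identity. Think of \<open>F = I f\<close>, \<open>G = I g\<close>, \<open>M = I (f G)\<close> and
  \<open>N = I (g F)\<close>, with subscripts for values at the points \<open>p\<close> and \<open>q\<close>. The left side is the product
  of the integrals of \<open>f h\<^sub>p\<close> and \<open>g h\<^sub>q\<close>; the two parenthesized summands on the right are the
  integrals of the two mixed products, after \<open>h\<^sub>p h\<^sub>q\<close> has been replaced by \<open>c h\<^sub>p + c' h\<^sub>q\<close>.
\<close>

lemma step_product_identity:
  fixes F G M N F\<^sub>p F\<^sub>q G\<^sub>p G\<^sub>q M\<^sub>p M\<^sub>q N\<^sub>p N\<^sub>q h\<^sub>p h\<^sub>q k\<^sub>p k\<^sub>q c c' :: "'a::comm_ring_1"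
  assumes h: "h\<^sub>p * h\<^sub>q = c * h\<^sub>p + c' * h\<^sub>q" and k: "k\<^sub>p * k\<^sub>q = c * k\<^sub>p + c' * k\<^sub>q"
    and "F * G = M + N" and "F\<^sub>p * G\<^sub>p = M\<^sub>p + N\<^sub>p" and "F\<^sub>q * G\<^sub>q = M\<^sub>q + N\<^sub>q"
  shows "((F - F\<^sub>p) * h\<^sub>p + F\<^sub>p * k\<^sub>p) * ((G - G\<^sub>q) * h\<^sub>q + G\<^sub>q * k\<^sub>q) =
    (c * ((M - M\<^sub>p) * h\<^sub>p + M\<^sub>p * k\<^sub>p) + c' * ((M - M\<^sub>q) * h\<^sub>q + M\<^sub>q * k\<^sub>q)
      - c * G\<^sub>q * ((F - F\<^sub>p) * h\<^sub>p + F\<^sub>p * k\<^sub>p) - c' * G\<^sub>q * ((F - F\<^sub>q) * h\<^sub>q + F\<^sub>q * k\<^sub>q)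
      + G\<^sub>q * k\<^sub>q * ((F - F\<^sub>p) * h\<^sub>p + F\<^sub>p * k\<^sub>p))
    + (c * ((N - N\<^sub>p) * h\<^sub>p + N\<^sub>p * k\<^sub>p) + c' * ((N - N\<^sub>q) * h\<^sub>q + N\<^sub>q * k\<^sub>q)
      - c * F\<^sub>p * ((G - G\<^sub>p) * h\<^sub>p + G\<^sub>p * k\<^sub>p) - c' * F\<^sub>p * ((G - G\<^sub>q) * h\<^sub>q + G\<^sub>q * k\<^sub>q)
      + F\<^sub>p * k\<^sub>p * ((G - G\<^sub>q) * h\<^sub>q + G\<^sub>q * k\<^sub>q))" (is "?l = ?r")
proof -
  have N: "N = F * G - M" "N\<^sub>p = F\<^sub>p * G\<^sub>p - M\<^sub>p" "N\<^sub>q = F\<^sub>q * G\<^sub>q - M\<^sub>q"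
    using assms by simp_all
  have "?l - ?r = (F - F\<^sub>p) * (G - G\<^sub>q) * (h\<^sub>p * h\<^sub>q - (c * h\<^sub>p + c' * h\<^sub>q))
      - F\<^sub>p * G\<^sub>q * (k\<^sub>p * k\<^sub>q - (c * k\<^sub>p + c' * k\<^sub>q))"
    unfolding N by (simp add: algebra_simps)
  also have "\<dots> = 0"
    by (simp add: h k)
  finally show ?thesis
    by simp
qed

text \<open>
  The algebra \<open>\<P>\<^sub>2\<F>\<close> as it is seen by the integral in one of its variables: \<open>hx p\<close> is the step at
  \<open>p\<close> in the variable of integration, \<open>hy v\<close> is the step at \<open>v\<close> in the other variable, and the
  first tensor factor carries the variable of integration. Both variables fit this description.
\<close>

locale piecewise = ordinary_shifted s I S + tensor_square_alg s s2 tens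
  for s :: "'k::linordered_field \<Rightarrow> 'f::comm_ring_1 \<Rightarrow> 'f"
    and I :: "'f \<Rightarrow> 'f"
    and S :: "'k \<Rightarrow> 'f \<Rightarrow> 'f"
    and s2 :: "'k \<Rightarrow> 't::comm_ring_1 \<Rightarrow> 't"
    and tens :: "'f \<Rightarrow> 'f \<Rightarrow> 't" +
  fixes emb :: "'t \<Rightarrow> 'a::comm_ring_1"
    and hx :: "'k point \<Rightarrow> 'a"
    and hy :: "'k step \<Rightarrow> 'a"
  assumes emb_add: "emb (t + t') = emb t + emb t'"
    and emb_mult: "emb (t * t') = emb t * emb t'"
    and emb_1: "emb 1 = 1"
    and hx_0: "hx (At 0) = 1"
    and hx_add: "hx (At (u + v)) = hx (At u) * hx (At v)"
    and hy_0: "hy 0 = 1"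
    and hy_add: "hy (u + v) = hy u * hy v"
    and diag_idem: "hx Diag * hx Diag = hx Diag"
    and diag_step: "hx (At u) * hx Diag = hy u * hx Diag + hx (At u) * (1 - hy u)"
    and spanning: "\<lbrakk>\<And>w w'. P w \<Longrightarrow> P w' \<Longrightarrow> P (w + w'); \<And>t p v. P (emb t * hx p * hy v)\<rbrakk> \<Longrightarrow> P w"
    and free: "(\<And>p v. additive (m p v)) \<Longrightarrow>
      \<exists>J :: 'a \<Rightarrow> 'a. additive J \<and> (\<forall>t p v. J (emb t * hx p * hy v) = m p v t)"
begin

definition scale :: "'k \<Rightarrow> 'a \<Rightarrow> 'a" where
  "scale c w = emb (s2 c 1) * w"

lemma emb_s2: "emb (s2 c t) = scale c (emb t)"
  using T.scale_as_mult[of c t] by (simp add: scale_def emb_mult)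

lemma k_algebra_scale: "k_algebra scale"
  unfolding k_algebra_def
proof (intro conjI allI)
  show "vector_space scale"
  proof
    fix a b :: 'k and x y :: 'a
    have "s2 (a * b) 1 = s2 a 1 * s2 b 1"
      using T.scale_as_mult[of a "s2 b 1"] by simp
    then show "scale a (scale b x) = scale (a * b) x"
      by (simp add: scale_def emb_mult ac_simps)
  qed (simp_all add: scale_def emb_add emb_1 algebra_simps T.scale_left_distrib)
qed (simp add: scale_def ac_simps)

sublocale A: k_algebra_ops scale
  by unfold_locales (rule k_algebra_scale)

text \<open>
  The value at a point, as an element of the algebra. The value \<open>0\<close> at \<open>-\<infinity>\<close> is a convention that
  makes the general formula for the integral of \<open>f h\<^sub>p\<close> give \<open>I f\<close> at this point; it keeps
  evaluation additive and multiplicative, though not unital.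
\<close>

definition ev :: "'k point \<Rightarrow> 'f \<Rightarrow> 'a" where
  "ev p f = (case p of
     At NoStep \<Rightarrow> 0
   | At (Step a) \<Rightarrow> scale (eval_at s I S a f) 1
   | Diag \<Rightarrow> emb (tens 1 f))"

text \<open>
  The indicator of \<open>p \<le> 0\<close>. It enters because the integral starts at \<open>0\<close>: for \<open>p \<le> 0\<close>, the
  antiderivative of \<open>f h\<^sub>p\<close> that vanishes at \<open>0\<close> is \<open>F\<close> to the right of \<open>p\<close>, and the constant \<open>F\<^sub>p\<close>
  to the left of it; for \<open>p > 0\<close> it is \<open>F - F\<^sub>p\<close> and \<open>0\<close>.
\<close>

definition nonpos :: "'k point \<Rightarrow> 'a" where
  "nonpos p = (case p of
     At NoStep \<Rightarrow> 1
   | At (Step a) \<Rightarrow> scale (heaviside_bar a) 1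
   | Diag \<Rightarrow> 1 - hy (Step 0))"

lemma ev_add: "ev p (f + g) = ev p f + ev p g"
  and ev_scale: "ev p (s c f) = scale c (ev p f)"
  and ev_mult: "ev p (f * g) = ev p f * ev p g"
proof -
  show "ev p (f + g) = ev p f + ev p g"
    by (auto simp: ev_def eval_at_add A.scale_left_distrib tens_add_right emb_add
        split: point.split step.split)
  show "ev p (s c f) = scale c (ev p f)"
    by (auto simp: ev_def eval_at_scale tens_scale_right emb_s2 split: point.split step.split)
  have "scale (a * b) 1 = scale a 1 * scale b 1" for a b
    using A.scale_mult_left[of a 1 "scale b 1"] by simp
  moreover have "tens 1 (f * g) = tens 1 f * tens 1 g"
    by (simp add: tens_mult)
  ultimately show "ev p (f * g) = ev p f * ev p g"
    by (auto simp: ev_def eval_at_mult emb_mult split: point.split step.split)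
qed

text \<open>
  The integral of \<open>f h\<^sub>p\<close>: one formula whose cases at \<open>-\<infinity>\<close>, at a number and on the diagonal are the
  three formulas that define the operator.
\<close>

definition gen_int :: "'k point \<Rightarrow> 'f \<Rightarrow> 'a" where
  "gen_int p f = (emb (tens (I f) 1) - ev p (I f)) * hx p + ev p (I f) * nonpos p"

lemma gen_int_add: "gen_int p (f + g) = gen_int p f + gen_int p g"
  by (simp add: gen_int_def I_add ev_add tens_add_left emb_add algebra_simps)

lemma gen_int_scale: "gen_int p (s c f) = scale c (gen_int p f)"
  by (simp add: gen_int_def I_scale ev_scale tens_scale_left emb_s2)
    (simp add: scale_def algebra_simps)

definition is_int :: "('a \<Rightarrow> 'a) \<Rightarrow> bool" where
  "is_int J \<longleftrightarrow> Vector_Spaces.linear scale scale J \<and>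
     (\<forall>g w. J (emb (tens 1 g) * w) = emb (tens 1 g) * J w) \<and>
     (\<forall>v w. J (hy v * w) = hy v * J w) \<and>
     (\<forall>p f. J (emb (tens f 1) * hx p) = gen_int p f)"

lemma gen_int_At_NoStep: "gen_int (At NoStep) f = emb (tens (I f) 1)"
  using hx_0 by (simp add: gen_int_def ev_def nonpos_def zero_step_def)

lemma gen_int_At_Step:
  "gen_int (At (Step a)) f = emb (tens (int_from s I S a f) 1) * hx (At (Step a))
    + scale (heaviside_bar a * int_from_to s I S 0 a f) 1"
proof -
  have "emb (tens (g - h) 1) = emb (tens g 1) - emb (tens h 1)" for g h
    by (rule additive.diff[of "\<lambda>h. emb (tens h 1)"]) (simp add: additive_def emb_add tens_add_left)
  then have "emb (tens (int_from s I S a f) 1)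
      = emb (tens (I f) 1) - scale (eval_at s I S a (I f)) 1"
    by (simp add: int_from_def tens_scale_left tens_1 emb_s2 emb_1)
  then show ?thesis
    by (simp add: gen_int_def ev_def nonpos_def int_from_to_0 A.scale_mult_left[symmetric]
        mult.commute)
qed

lemma gen_int_Diag:
  "gen_int Diag f = (emb (tens (I f) 1) - emb (tens 1 (I f))) * hx Diag
    + emb (tens 1 (I f)) * (1 - hy (Step 0))"
  by (simp add: gen_int_def ev_def nonpos_def)

lemma is_int_iff:
  "is_int J \<longleftrightarrow> Vector_Spaces.linear scale scale J \<and>
     (\<forall>g w. J (emb (tens 1 g) * w) = emb (tens 1 g) * J w) \<and>
     (\<forall>a w. J (hy (Step a) * w) = hy (Step a) * J w) \<and>
     (\<forall>f. J (emb (tens f 1)) = emb (tens (I f) 1)) \<and>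
     (\<forall>f a. J (emb (tens f 1) * hx (At (Step a))) =
        emb (tens (int_from s I S a f) 1) * hx (At (Step a))
        + scale (heaviside_bar a * int_from_to s I S 0 a f) 1) \<and>
     (\<forall>f. J (emb (tens f 1) * hx Diag) =
        (emb (tens (I f) 1) - emb (tens 1 (I f))) * hx Diag
        + emb (tens 1 (I f)) * (1 - hy (Step 0)))"
proof -
  have all_step: "(\<forall>v. P v) \<longleftrightarrow> P NoStep \<and> (\<forall>a. P (Step a))" for P :: "'k step \<Rightarrow> bool"
    by (metis step.exhaust)
  have all_point: "(\<forall>p. P p) \<longleftrightarrow> (\<forall>u. P (At u)) \<and> P Diag" for P :: "'k point \<Rightarrow> bool"
    by (metis point.exhaust)
  show ?thesis
    unfolding is_int_def all_point all_step gen_int_At_NoStep gen_int_At_Step gen_int_Diag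
    using hx_0 hy_0 by (auto simp: zero_step_def)
qed

lemma generators_induct [case_names add gen]:
  assumes add: "\<And>w w'. P w \<Longrightarrow> P w' \<Longrightarrow> P (w + w')"
    and gen: "\<And>f g p v. P (emb (tens 1 g) * hy v * (emb (tens f 1) * hx p))"
  shows "P w"
proof (rule spanning[of P, OF add])
  fix t p v
  show "P (emb t * hx p * hy v)"
  proof (induction t rule: tensor_induct)
    case (add t t')
    then show ?case
      using assms(1) by (simp add: emb_add distrib_right)
  next
    case (tens f g)
    have "emb (tens f g) = emb (tens f 1) * emb (tens 1 g)"
      by (simp add: emb_mult[symmetric] tens_mult)
    then have "emb (tens f g) * hx p * hy v = emb (tens 1 g) * hy v * (emb (tens f 1) * hx p)"
      by (simp add: ac_simps)
    then show ?case
      by (simp only: gen)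
  qed
qed

lemma is_int_unique:
  assumes "is_int J" and "is_int J'"
  shows "J = J'"
proof
  fix w
  show "J w = J' w"
  proof (induction w rule: generators_induct)
    case (add w w')
    then show ?case
      using assms by (simp add: is_int_def Vector_Spaces.linear_iff)
  next
    case (gen f g p v)
    show ?case
      using assms by (simp add: is_int_def mult.assoc)
  qed
qed

text \<open>
  By freeness the operator may be prescribed on the basis, where it is given componentwise by the
  universal property of the tensor square. Its linearity over the constants is then checked on the
  basis.
\<close>

lemma is_int_exists: "\<exists>J. is_int J"
proof -
  have "\<exists>L. Vector_Spaces.linear s2 scale L
      \<and> (\<forall>f g. L (tens f g) = emb (tens 1 g) * gen_int p f)" for p
    by (rule tensor_universal[OF A.vector_space_axioms, of "\<lambda>f g. emb (tens 1 g) * gen_int p f"])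
      (auto simp: gen_int_add gen_int_scale tens_add_right emb_add tens_scale_right emb_s2
        A.scale_mult_left[symmetric] A.scale_mult_right[symmetric] distrib_left distrib_right)
  then obtain L where "\<forall>p. Vector_Spaces.linear s2 scale (L p)
      \<and> (\<forall>f g. L p (tens f g) = emb (tens 1 g) * gen_int p f)"
    by metis
  then have L_add: "L p (t + t') = L p t + L p t'" and L_scale: "L p (s2 c t) = scale c (L p t)"
    and L_tens: "L p (tens f g) = emb (tens 1 g) * gen_int p f" for p t t' c f g
    by (simp_all add: Vector_Spaces.linear_iff)
  have "additive (\<lambda>t. hy v * L p t)" for p v
    by (simp add: additive_def L_add distrib_left)
  from free[of "\<lambda>p v t. hy v * L p t", OF this] obtain J where "additive J"
    and J: "\<And>t p v. J (emb t * hx p * hy v) = hy v * L p t"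
    by blast
  interpret J: additive J by fact
  have L_mult: "L p (tens 1 g * t) = emb (tens 1 g) * L p t" for p g t
  proof (induction t rule: tensor_induct)
    case (tens f' g')
    have "emb (tens 1 (g * g')) = emb (tens 1 g) * emb (tens 1 g')"
      by (simp add: emb_mult[symmetric] tens_mult)
    then show ?case
      by (simp add: tens_mult L_tens mult.assoc)
  qed (simp add: distrib_left L_add)
  have "J (scale c w) = scale c (J w)" for c w
  proof (induction w rule: spanning)
    case (2 t p v)
    have "scale c (emb t * hx p * hy v) = emb (s2 c t) * hx p * hy v"
      by (simp add: emb_s2 A.scale_mult_left)
    then show ?case
      by (simp add: J L_scale A.scale_mult_right)
  qed (simp add: A.scale_right_distrib J.add)
  moreover have "J (emb (tens 1 g) * w) = emb (tens 1 g) * J w" for g w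
  proof (induction w rule: spanning)
    case (2 t p v)
    have eq: "emb (tens 1 g) * (emb t * hx p * hy v) = emb (tens 1 g * t) * hx p * hy v"
      by (simp add: emb_mult ac_simps)
    show ?case
      unfolding eq J L_mult by (simp add: ac_simps)
  qed (simp add: distrib_left J.add)
  moreover have "J (hy u * w) = hy u * J w" for u w
  proof (induction w rule: spanning)
    case (2 t p v)
    have eq: "hy u * (emb t * hx p * hy v) = emb t * hx p * hy (u + v)"
      by (simp add: hy_add ac_simps)
    show ?case
      unfolding eq J by (simp add: hy_add ac_simps)
  qed (simp add: distrib_left J.add)
  moreover have "J (emb (tens f 1) * hx p) = gen_int p f" for f p
    using J[of "tens f 1" p 0] by (simp add: hy_0 L_tens tens_1 emb_1)
  ultimately have "is_int J"
    by (simp add: is_int_def Vector_Spaces.linear_iff A.vector_space_axioms J.add)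
  then show ?thesis
    by blast
qed

context
  fixes J
  assumes J: "is_int J"
begin

interpretation J: additive J
  using J by (simp add: is_int_def Vector_Spaces.linear_iff additive_def)

text \<open>
  The constants of integration. Since they can be moved out of both sides of the Rota-Baxter
  identity, it suffices to prove it for elements that span the algebra over them.
\<close>

definition const :: "'a \<Rightarrow> bool" where
  "const r \<longleftrightarrow> (\<forall>w. J (r * w) = r * J w)"

lemma const_diff: "const r \<Longrightarrow> const r' \<Longrightarrow> const (r - r')"
  and const_mult: "const r \<Longrightarrow> const r' \<Longrightarrow> const (r * r')"
  by (simp_all add: const_def left_diff_distrib J.diff mult.assoc)

lemma const_0: "const 0" and const_1: "const 1"
  by (simp_all add: const_def J.zero)

lemma const_emb: "const (emb (tens 1 g))"
  and const_hy: "const (hy v)"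
  and J_gen: "J (emb (tens f 1) * hx p) = gen_int p f"
  using J by (simp_all add: const_def is_int_def)

lemma const_scale: "const (scale c 1)"
  using J by (simp add: const_def is_int_def Vector_Spaces.linear_iff A.scale_mult_left[symmetric])

lemma const_ev: "const (ev p f)"
  by (auto simp: ev_def const_0 const_emb const_scale split: point.split step.split)

lemma const_nonpos: "const (nonpos p)"
  by (auto simp: nonpos_def const_1 const_hy const_diff const_scale split: point.split step.split)

text \<open>
  The product of two steps is the step at the larger point. The constants \<open>c\<close> and \<open>c'\<close> indicate
  whether this is \<open>p\<close> or \<open>q\<close>, so that they also compute the indicator that both points are
  nonpositive. Between two numbers they are \<open>0\<close> and \<open>1\<close>; between a number \<open>u\<close> and the diagonal they
  are \<open>1 - hy u\<close> and \<open>hy u\<close>, since \<open>hy u\<close> indicates that the other variable exceeds \<open>u\<close>.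
\<close>

lemma hx_mult_decomposition:
  obtains c c' where "const c" "const c'" "hx p * hx q = c * hx p + c' * hx q"
    "nonpos p * nonpos q = c * nonpos p + c' * nonpos q"
proof -
  have half: "const (hy u)" "const (1 - hy u)"
      "hx (At u) * hx Diag = (1 - hy u) * hx (At u) + hy u * hx Diag"
      "nonpos (At u) * nonpos Diag = (1 - hy u) * nonpos (At u) + hy u * nonpos Diag" for u
  proof -
    show "const (hy u)" "const (1 - hy u)"
      by (simp_all add: const_hy const_diff const_1)
    show "hx (At u) * hx Diag = (1 - hy u) * hx (At u) + hy u * hx Diag"
      unfolding diag_step by (simp add: ac_simps)
    show "nonpos (At u) * nonpos Diag = (1 - hy u) * nonpos (At u) + hy u * nonpos Diag"
    proof (cases u)
      case NoStep
      then have "hy u = 1"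
        by (simp add: hy_0[unfolded zero_step_def])
      then show ?thesis
        by (simp add: nonpos_def NoStep)
    next
      case (Step a)
      have *: "hy (Step a) * hy (Step 0) = hy (Step (max a 0))"
        by (simp add: hy_add[symmetric])
      show ?thesis
        using * by (cases "a \<le> 0")
          (simp_all add: nonpos_def Step heaviside_bar_def heaviside_def max_def algebra_simps)
    qed
  qed
  show thesis
  proof (cases p; cases q)
    fix u v
    assume p: "p = At u" and q: "q = At v"
    have "hx p * hx q = hx (At (u + v))" and "nonpos p * nonpos q = nonpos (At (u + v))"
      using p q
      by (simp add: hx_add)
        (cases u; cases v; simp add: p q nonpos_def heaviside_bar_def heaviside_def max_def)
    then show thesis
      using step_plus_cases[of u v] that[of 1 0] that[of 0 1] p q
      by (auto simp: const_0 const_1)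
  next
    fix u
    assume "p = At u" and "q = Diag"
    with half[of u] show thesis
      using that[of "1 - hy u" "hy u"] by blast
  next
    fix v
    assume "p = Diag" and "q = At v"
    with half[of v] show thesis
      using that[of "hy v" "1 - hy v"] by (simp add: ac_simps)
  next
    assume "p = Diag" and "q = Diag"
    moreover have "nonpos Diag * nonpos Diag = nonpos Diag"
      using hy_add[of "Step 0" "Step 0"] by (simp add: nonpos_def algebra_simps)
    ultimately show thesis
      using that[of 1 0] by (simp add: const_0 const_1 diag_idem)
  qed
qed

text \<open>
  The mixed products are combinations of \<open>hx p\<close> and \<open>hx q\<close> with coefficients that are functions of
  the variable of integration times constants, so their integrals are again given by \<open>gen_int\<close>.
\<close>

lemma rota_baxter_generators:
  fixes f g p q
  defines "u \<equiv> emb (tens f 1) * hx p" and "v \<equiv> emb (tens g 1) * hx q"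
  shows "J u * J v = J (u * J v) + J (v * J u)"
proof -
  obtain c c' where const: "const c" "const c'" and hh: "hx p * hx q = c * hx p + c' * hx q"
    and kk: "nonpos p * nonpos q = c * nonpos p + c' * nonpos q"
    by (rule hx_mult_decomposition)
  let ?X = "\<lambda>f. emb (tens f 1)"
  have X_mult: "?X (a * b) = ?X a * ?X b" for a b
    by (simp add: emb_mult[symmetric] tens_mult)
  define Fp Gq where "Fp = ev p (I f)" and "Gq = ev q (I g)"
  have cFG: "const Fp" "const Gq"
    by (simp_all add: Fp_def Gq_def const_ev)
  have J_const: "J (r * (?X h * hx k)) = r * gen_int k h" if "const r" for r h k
    using that J_gen by (simp add: const_def)
  have "u * J v = c * (?X (f * I g) * hx p) + c' * (?X (f * I g) * hx q)
      - (c * Gq) * (?X f * hx p) - (c' * Gq) * (?X f * hx q) + (Gq * nonpos q) * (?X f * hx p)"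
    unfolding u_def v_def J_gen gen_int_def X_mult Gq_def[symmetric]
    using arg_cong[OF hh, of "\<lambda>z. ?X f * (?X (I g) - Gq) * z"] by (simp add: algebra_simps)
  then have uJv: "J (u * J v) = c * gen_int p (f * I g) + c' * gen_int q (f * I g)
      - c * Gq * gen_int p f - c' * Gq * gen_int q f + Gq * nonpos q * gen_int p f"
    by (simp add: J.add J.diff J_const const const_mult cFG const_nonpos)
  have "v * J u = c * (?X (g * I f) * hx p) + c' * (?X (g * I f) * hx q)
      - (c * Fp) * (?X g * hx p) - (c' * Fp) * (?X g * hx q) + (Fp * nonpos p) * (?X g * hx q)"
    unfolding u_def v_def J_gen gen_int_def X_mult Fp_def[symmetric]
    using arg_cong[OF hh, of "\<lambda>z. ?X g * (?X (I f) - Fp) * z"] by (simp add: algebra_simps)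
  then have vJu: "J (v * J u) = c * gen_int p (g * I f) + c' * gen_int q (g * I f)
      - c * Fp * gen_int p g - c' * Fp * gen_int q g + Fp * nonpos p * gen_int q g"
    by (simp add: J.add J.diff J_const const const_mult cFG const_nonpos)
  have X_int: "?X (I f) * ?X (I g) = ?X (I (f * I g)) + ?X (I (g * I f))"
    by (simp add: X_mult[symmetric] I_mult tens_add_left emb_add)
  have ev_int: "ev k (I f) * ev k (I g) = ev k (I (f * I g)) + ev k (I (g * I f))" for k
    by (simp add: ev_mult[symmetric] I_mult ev_add)
  show ?thesis
    unfolding uJv vJu unfolding u_def v_def J_gen gen_int_def Fp_def Gq_def
    by (rule step_product_identity[OF hh kk X_int ev_int ev_int])
qed

lemma rota_baxter_int: "rota_baxter_algebra scale J"
proof -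
  have "J u * J v = J (u * J v) + J (v * J u)" for u v
  proof (induction u rule: generators_induct)
    case (add u u')
    then show ?case
      by (simp add: J.add distrib_left distrib_right)
  next
    case (gen f g p a)
    define r u where "r = emb (tens 1 g) * hy a" and "u = emb (tens f 1) * hx p"
    have "const r"
      by (simp add: r_def const_mult const_emb const_hy)
    then have r: "J (r * w) = r * J w" for w
      by (simp add: const_def)
    have "J (r * u) * J v = J (r * u * J v) + J (v * J (r * u))"
    proof (induction v rule: generators_induct)
      case (add v v')
      then show ?case
        by (simp add: J.add distrib_left distrib_right)
    next
      case (gen f' g' q b)
      define r' v where "r' = emb (tens 1 g') * hy b" and "v = emb (tens f' 1) * hx q"
      have "const r'"
        by (simp add: r'_def const_mult const_emb const_hy)
      then have r': "J (r' * w) = r' * J w" for w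
        by (simp add: const_def)
      have "J u * J v = J (u * J v) + J (v * J u)"
        unfolding u_def v_def by (rule rota_baxter_generators)
      moreover have "J (r * u * J (r' * v)) = r * r' * J (u * J v)"
      proof -
        have "r * u * J (r' * v) = r * (r' * (u * J v))"
          by (simp add: r' ac_simps)
        from arg_cong[OF this, of J] show ?thesis
          by (rule trans) (simp add: r r' mult.assoc)
      qed
      moreover have "J (r' * v * J (r * u)) = r * r' * J (v * J u)"
      proof -
        have "r' * v * J (r * u) = r * (r' * (v * J u))"
          by (simp add: r ac_simps)
        from arg_cong[OF this, of J] show ?thesis
          by (rule trans) (simp add: r r' mult.assoc)
      qed
      moreover have "J (r * u) * J (r' * v) = r * r' * (J u * J v)"
        by (simp add: r r' ac_simps)
      ultimately have "J (r * u) * J (r' * v) = J (r * u * J (r' * v)) + J (r' * v * J (r * u))"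
        by (simp add: distrib_left)
      then show ?case
        by (simp only: r'_def v_def)
    qed
    then show ?case
      by (simp only: r_def u_def)
  qed
  then show ?thesis
    using J by (simp add: rota_baxter_algebra_def k_algebra_scale is_int_def)
qed

text \<open>
  On the embedded tensor square the operator is determined by its values on pure tensors, and these
  are the defining values of the integral in the first factor.
\<close>

lemma int_emb: "J (emb t) = emb (int2_x I s2 tens t)"
proof -
  obtain L where L: "Vector_Spaces.linear s2 s2 L" "\<And>f g. L (tens f g) = tens (I f) g"
    by (rule tensor_universal[OF T.vector_space_axioms, of "\<lambda>f g. tens (I f) g"])
      (simp_all add: I_add I_scale tens_relations)
  have "int2_x I s2 tens = L"
    unfolding int2_x_def
  proof (rule the_equality)
    fix L'
    assume L': "Vector_Spaces.linear s2 s2 L' \<and> (\<forall>f g. L' (tens f g) = tens (I f) g)"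
    show "L' = L"
    proof
      show "L' t = L t" for t
        by (induction t rule: tensor_induct)
          (use L L' in \<open>simp_all add: Vector_Spaces.linear_iff\<close>)
    qed
  qed (use L in blast)
  moreover have "J (emb t) = emb (L t)"
  proof (induction t rule: tensor_induct)
    case (add t t')
    then show ?case
      using L by (simp add: emb_add J.add Vector_Spaces.linear_iff)
  next
    case (tens f g)
    \<comment> \<open>The embedded tensor square consists of multiples of the step at \<open>-\<infinity>\<close>.\<close>
    have split: "emb (tens f g) = emb (tens 1 g) * (emb (tens f 1) * hx (At 0))" for f
      by (simp add: hx_0 emb_mult[symmetric] tens_mult)
    have "J (emb (tens f g)) = emb (tens 1 g) * gen_int (At 0) f"
      unfolding split[of f] using const_emb by (simp add: const_def J_gen)
    also have "\<dots> = emb (tens (I f) g)"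
      unfolding split[of "I f"] by (simp add: gen_int_def ev_def zero_step_def)
    finally show ?case
      by (simp add: L)
  qed
  ultimately show ?thesis
    by simp
qed

end

end

section \<open>The two variables of the piecewise extension\<close>

lemma piecewise_p2:
  fixes s :: "'k::linordered_field \<Rightarrow> 'f::comm_ring_1 \<Rightarrow> 'f"
    and s2 :: "'k \<Rightarrow> 't::comm_ring_1 \<Rightarrow> 't"
  assumes "ordinary_rota_baxter s I" and "shifted_rota_baxter s I S" and "tensor_square s s2 tens"
  shows "piecewise s I S s2 tens p2_emb p2_point step_xi"
proof unfold_locales
  fix P :: "('k, 't) p2 \<Rightarrow> bool" and w
  assume "\<And>w w'. P w \<Longrightarrow> P w' \<Longrightarrow> P (w + w')" and "\<And>t p v. P (p2_emb t * p2_point p * step_xi v)"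
  then show "P w"
    by (rule p2_point_induct)
next
  fix m :: "'k point \<Rightarrow> 'k step \<Rightarrow> 't \<Rightarrow> ('k, 't) p2"
  assume "\<And>p v. additive (m p v)"
  then show "\<exists>J. additive J \<and> (\<forall>t p v. J (p2_emb t * p2_point p * step_xi v) = m p v t)"
    using p2_free[of m] by metis
qed (use assms in \<open>simp_all add: p2_emb_add p2_emb_mult p2_emb_1 step_x_0 step_x_add step_xi_0
    step_xi_add h_diff_idem step_x_h_diff\<close>)

text \<open>
  The same algebra with the roles of the variables exchanged. The step \<open>H(\<xi> - x)\<close> at the diagonal is
  represented by \<open>1 - H(x - \<xi>)\<close>.
\<close>

fun p2_mirror_point :: "'k::linorder point \<Rightarrow> ('k, 't::comm_ring_1) p2" where
  "p2_mirror_point (At v) = step_xi v"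
| "p2_mirror_point Diag = 1 - h_diff"

text \<open>
  The mixed relation is invariant under the exchange of variables. Solved for the products with steps
  in \<open>x\<close> or in \<open>\<xi>\<close>, it gives the change of basis between \<open>H(x - \<xi>) H\<^sub>u(\<xi>)\<close> and
  \<open>H(\<xi> - x) H\<^sub>u(x)\<close>.
\<close>

lemma mirror_diag:
  "(1 - h_diff) * step_x u = step_x u * step_xi u - step_xi u * h_diff"
  "h_diff * step_xi u = step_x u * step_xi u - (1 - h_diff) * step_x u"
  using step_x_h_diff[of u, symmetric] by (simp_all add: algebra_simps)

lemma p2_mirror_point_induct:
  fixes w :: "('k::linorder, 't::comm_ring_1) p2"
  assumes add: "\<And>u v. P u \<Longrightarrow> P v \<Longrightarrow> P (u + v)"
    and gen: "\<And>t p u. P (p2_emb t * p2_mirror_point p * step_x u)"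
  shows "P w"
proof (induction w rule: p2_point_induct)
  case (gen t p v)
  show ?case
  proof (cases p)
    case (At u)
    then show ?thesis
      using assms(2)[of t "At v" u] by (simp add: ac_simps)
  next
    case Diag
    have "p2_emb t * p2_point p * step_xi v
        = p2_emb t * step_xi v * step_x v + p2_emb (- t) * (1 - h_diff) * step_x v"
      by (simp add: Diag mult.assoc mirror_diag additive.minus[OF additive_p2_emb])
        (simp add: algebra_simps)
    also have "P \<dots>"
      using assms(2)[of t "At v" v] assms(2)[of "- t" Diag v] by (intro add) simp_all
    finally show ?thesis .
  qed
qed (rule add)

text \<open>
  Freeness on the mirrored basis follows from freeness on the original one by the change of basis:
  the values \<open>m'\<close> are those which a map with the values \<open>m\<close> takes on the original basis.
\<close>

lemma p2_mirror_free:
  fixes m :: "'k::linorder point \<Rightarrow> 'k step \<Rightarrow> 't::comm_ring_1 \<Rightarrow> 'c::ab_group_add"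
  assumes add: "\<And>p v. additive (m p v)"
  obtains J :: "('k, 't) p2 \<Rightarrow> 'c" where "additive J"
    and "\<And>t p u. J (p2_emb t * p2_mirror_point p * step_x u) = m p u t"
proof -
  define m' where "m' p v t = (case p of At u \<Rightarrow> m (At v) u t | Diag \<Rightarrow> m (At v) v t - m Diag v t)"
    for p v t
  have "additive (m' p v)" for p v
    by (cases p) (simp_all add: m'_def additive_def additive.add[OF add])
  then obtain J :: "('k, 't) p2 \<Rightarrow> 'c" where "additive J"
    and J: "\<And>t p v. J (p2_emb t * p2_point p * step_xi v) = m' p v t"
    using p2_free[of m'] by metis
  interpret J: additive J by fact
  show thesis
  proof
    show "additive J" by fact
    fix t p u
    have At: "J (p2_emb t * step_xi v * step_x u) = m (At v) u t" for v u
      using J[of t "At u" v] by (simp add: m'_def ac_simps)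
    show "J (p2_emb t * p2_mirror_point p * step_x u) = m p u t"
    proof (cases p)
      case (At v)
      then show ?thesis
        by (simp add: \<open>\<And>v u. J (p2_emb t * step_xi v * step_x u) = m (At v) u t\<close>)
    next
      case Diag
      have "p2_emb t * p2_mirror_point p * step_x u
          = p2_emb t * step_xi u * step_x u - p2_emb t * p2_point Diag * step_xi u"
        by (simp add: Diag mult.assoc mirror_diag) (simp add: algebra_simps)
      then show ?thesis
        by (simp only: J.diff At J) (simp add: m'_def Diag)
    qed
  qed
qed

lemma piecewise_p2_mirror:
  fixes s :: "'k::linordered_field \<Rightarrow> 'f::comm_ring_1 \<Rightarrow> 'f"
    and s2 :: "'k \<Rightarrow> 't::comm_ring_1 \<Rightarrow> 't"
  assumes "ordinary_rota_baxter s I" and "shifted_rota_baxter s I S" and "tensor_square s s2 tens"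
  shows "piecewise s I S s2 (\<lambda>f g. tens g f) p2_emb p2_mirror_point step_x"
proof unfold_locales
  show "tensor_square s s2 (\<lambda>f g. tens g f)"
    by (rule tensor_square_swap) fact
  fix P :: "('k, 't) p2 \<Rightarrow> bool" and w
  assume "\<And>w w'. P w \<Longrightarrow> P w' \<Longrightarrow> P (w + w')"
    and "\<And>t p u. P (p2_emb t * p2_mirror_point p * step_x u)"
  then show "P w"
    by (rule p2_mirror_point_induct)
next
  fix m :: "'k point \<Rightarrow> 'k step \<Rightarrow> 't \<Rightarrow> ('k, 't) p2"
  assume "\<And>p v. additive (m p v)"
  then show "\<exists>J. additive J \<and> (\<forall>t p u. J (p2_emb t * p2_mirror_point p * step_x u) = m p u t)"
    using p2_mirror_free[of m] by metis
next
  show "p2_mirror_point Diag * p2_mirror_point Diag = (p2_mirror_point Diag :: ('k, 't) p2)"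
    by (simp add: algebra_simps h_diff_idem)
  fix u :: "'k step"
  show "p2_mirror_point (At u) * p2_mirror_point Diag
      = step_x u * p2_mirror_point Diag + p2_mirror_point (At u) * (1 - step_x u :: ('k, 't) p2)"
    using step_x_h_diff[of u] by (simp add: algebra_simps)
qed (use assms in \<open>simp_all add: p2_emb_add p2_emb_mult p2_emb_1 step_x_0 step_x_add step_xi_0
    step_xi_add\<close>)

text \<open>
  Sending all steps and \<open>H(x - \<xi>)\<close> to zero is a left inverse of the embedding.
\<close>

lemma inj_p2_emb: "inj (p2_emb :: 't::comm_ring_1 \<Rightarrow> ('k::linorder, 't) p2)"
proof (rule injI)
  fix t t' :: 't
  assume "p2_emb t = (p2_emb t' :: ('k, 't) p2)"
  then have "p2_const ([:px_xi_emb t:] - [:px_xi_emb t':] :: ('k, 't) px_xi poly) = 0"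
    by (intro p2_const_ideal)
      (simp add: p2_emb_def p2_of_px_xi_def p2.abs_eq_iff p2_rel_def)
  then show "t = t'"
    by (simp add: p2_const_def px_xi_emb_def lookup_minus zero_prod_def zero_step_def)
qed

section \<open>The duplex Rota-Baxter structure\<close>

lemma int_p2_x_characterized:
  fixes s :: "'k::linordered_field \<Rightarrow> 'f::comm_ring_1 \<Rightarrow> 'f"
    and s2 :: "'k \<Rightarrow> 't::comm_ring_1 \<Rightarrow> 't"
  assumes "piecewise s I S s2 tens p2_emb p2_point step_xi"
  shows "piecewise.is_int s I S s2 tens p2_emb p2_point step_xi (int_p2_x s I S s2 tens)"
proof -
  interpret piecewise s I S s2 tens p2_emb p2_point step_xi
    by fact
  have "scale = p2_scale s2"
    by (simp add: fun_eq_iff scale_def p2_scale_def)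
  then have "is_int_p2_x s I S s2 tens J \<longleftrightarrow> is_int J" for J
    by (simp add: is_int_iff is_int_p2_x_def fun_x_def fun_xi_def h_x_eq h_xi_eq)
  then have "is_int_p2_x s I S s2 tens = is_int"
    by (rule ext)
  then show ?thesis
    unfolding int_p2_x_def using is_int_exists is_int_unique by (metis theI)
qed

text \<open>
  The formula for the integral of \<open>g(\<xi>) H(x - \<xi>)\<close> is equivalent to the general formula at the
  mirrored diagonal \<open>1 - H(x - \<xi>)\<close>, given linearity and the value of the integral on \<open>g(\<xi>)\<close> itself.
\<close>

lemma int_p2_xi_characterized:
  fixes s :: "'k::linordered_field \<Rightarrow> 'f::comm_ring_1 \<Rightarrow> 'f"
    and s2 :: "'k \<Rightarrow> 't::comm_ring_1 \<Rightarrow> 't"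
  assumes "piecewise s I S s2 (\<lambda>f g. tens g f) p2_emb p2_mirror_point step_x"
  shows "piecewise.is_int s I S s2 (\<lambda>f g. tens g f) p2_emb p2_mirror_point step_x
    (int_p2_xi s I S s2 tens)"
proof -
  interpret piecewise s I S s2 "\<lambda>f g. tens g f" p2_emb p2_mirror_point step_x
    by fact
  have scale: "scale = p2_scale s2"
    by (simp add: fun_eq_iff scale_def p2_scale_def)
  have "is_int_p2_xi s I S s2 tens J \<longleftrightarrow> is_int J" for J
  proof -
    have diag: "J (p2_emb (tens 1 g) * (1 - h_diff)) =
          (p2_emb (tens 1 (I g)) - p2_emb (tens (I g) 1)) * (1 - h_diff)
          + p2_emb (tens (I g) 1) * (1 - step_x (Step 0)) \<longleftrightarrow>
        J (p2_emb (tens 1 g) * h_diff) =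
          (p2_emb (tens 1 (I g)) - p2_emb (tens (I g) 1)) * h_diff
          + p2_emb (tens (I g) 1) * step_x (Step 0)"
      if "Vector_Spaces.linear (p2_scale s2) (p2_scale s2) J"
        and "J (p2_emb (tens 1 g)) = p2_emb (tens 1 (I g))" for g
    proof -
      interpret J: additive J
        using that by (simp add: Vector_Spaces.linear_iff additive_def)
      have left: "J (p2_emb (tens 1 g) * (1 - h_diff))
          = p2_emb (tens 1 (I g)) - J (p2_emb (tens 1 g) * h_diff)"
        using that by (simp add: right_diff_distrib J.diff)
      have right: "(G - F) * (1 - h_diff) + F * (1 - t) = G - ((G - F) * h_diff + F * t)"
        for F G t :: "('k, 't) p2"
        by (simp add: algebra_simps)
      have cancel: "a - b = a - c \<longleftrightarrow> b = c" for a b c :: "('k, 't) p2"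
        by simp
      show ?thesis
        unfolding left right by (rule cancel)
    qed
    show ?thesis
      unfolding is_int_iff is_int_p2_xi_def fun_x_def fun_xi_def h_x_eq h_xi_eq scale
        p2_mirror_point.simps
      using diag by (intro conj_cong refl) auto
  qed
  then have "is_int_p2_xi s I S s2 tens = is_int"
    by (rule ext)
  then show ?thesis
    unfolding int_p2_xi_def using is_int_exists is_int_unique by (metis theI)
qed

theorem proposition23:
  fixes s :: "'k::linordered_field \<Rightarrow> 'f::comm_ring_1 \<Rightarrow> 'f"
    and I :: "'f \<Rightarrow> 'f"
    and S :: "'k \<Rightarrow> 'f \<Rightarrow> 'f"
    and s2 :: "'k \<Rightarrow> 't::comm_ring_1 \<Rightarrow> 't"
    and tens :: "'f \<Rightarrow> 'f \<Rightarrow> 't"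
  assumes "ordinary_rota_baxter s I"
    and "shifted_rota_baxter s I S"
    and "tensor_square s s2 tens"
  shows "duplex_rota_baxter (p2_scale s2) (int_p2_x s I S s2 tens) (int_p2_xi s I S s2 tens) \<and>
    duplex_extends (p2_scale s2) (int_p2_x s I S s2 tens) (int_p2_xi s I S s2 tens)
      s2 (int2_x I s2 tens) (int2_xi I s2 tens) p2_emb"
proof -
  interpret X: piecewise s I S s2 tens p2_emb p2_point "step_xi :: _ \<Rightarrow> ('k, 't) p2"
    by (rule piecewise_p2) fact+
  interpret Xi: piecewise s I S s2 "\<lambda>f g. tens g f" p2_emb p2_mirror_point
    "step_x :: _ \<Rightarrow> ('k, 't) p2"
    by (rule piecewise_p2_mirror) fact+
  note int_x = int_p2_x_characterized[OF X.piecewise_axioms]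
  note int_xi = int_p2_xi_characterized[OF Xi.piecewise_axioms]
  have scale: "X.scale = p2_scale s2" "Xi.scale = p2_scale s2"
    by (simp_all add: fun_eq_iff X.scale_def Xi.scale_def p2_scale_def)
  have "int2_xi I s2 tens = int2_x I s2 (\<lambda>f g. tens g f)"
    unfolding int2_xi_def int2_x_def by (subst all_comm) (rule refl)
  moreover have "k_algebra_hom s2 (p2_scale s2) (p2_emb :: 't \<Rightarrow> ('k, 't) p2)"
    using X.emb_s2 X.T.vector_space_axioms X.A.vector_space_axioms
    by (simp add: k_algebra_hom_def Vector_Spaces.linear_iff p2_emb_add p2_emb_mult p2_emb_1 scale)
  ultimately show ?thesis
    using X.rota_baxter_int[OF int_x] Xi.rota_baxter_int[OF int_xi]
      X.int_emb[OF int_x] Xi.int_emb[OF int_xi]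
    by (simp add: duplex_rota_baxter_def duplex_extends_def scale inj_p2_emb)
qed

end
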